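(* Let $n\ge 1$ be an integer, $\beta>0$, $\mu>0$, and let $\mathcal{E}$ be a Gaussian white noise on $\mathbb{R}$ with intensity $\sigma^2$. Then a solution to the equation $$\left(\mu+(-1)^n\frac{\partial^{2n}}{\partial t^{2n}}\right)^{\beta}X(t)=\mathcal{E}(t)$$ is represented by $$X(t)=\frac{1}{\Gamma(\beta)}\int_0^\infty w^{\beta-1}e^{-\mu w}\int_{-\infty}^{+\infty}u_{2n}(x,w)\,\mathcal{E}(t+x)\,dx\,dw.$$ Moreover, the spectral function $f(\tau)=\int_{-\infty}^{+\infty}e^{i\tau h}\,\mathrm{Cov}_X(h)\,dh$ of $X$ is $$f(\tau)=\frac{\sigma^2}{(\mu+\tau^{2n})^{2\beta}},\qquad\tau\in\mathbb{R},$$ and the covariance function is $$\mathrm{Cov}_X(h)=\frac{\sigma^2}{\mu^{2\beta}}\,\mathbb{E}\left[u_{2n}(h,W_{2\beta})\right],$$ where $W_{2\beta}$ is a gamma random variable with shape $2\beta$ and rate $\mu$, i.e. with density $\frac{\mu^{2\beta}}{\Gamma(2\beta)}w^{2\beta-1}e^{-\mu w}$, $w>0$.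
   Context: $u_{2n}(x,w)$, $x\in\mathbb{R}$, $w>0$, is the fundamental solution of the $2n$-th order heat equation $$\frac{\partial u}{\partial w}(x,w)=(-1)^{n+1}\frac{\partial^{2n}u}{\partial x^{2n}}(x,w),$$ i.e. the solution with initial datum $\delta(x)$; its Fourier transform is $\int_{\mathbb{R}}e^{i\xi x}u_{2n}(x,w)\,dx=e^{-\xi^{2n}w}$. White noise: $\mathcal{E}$ is a centered Gaussian linear family $\{\mathcal{E}(\varphi):\varphi\in L^2(\mathbb{R})\}$ with $\mathbb{E}[\mathcal{E}(\varphi)\mathcal{E}(\psi)]=\sigma^2\int_{\mathbb{R}}\varphi\psi\,dt$; formally $\mathcal{E}(\varphi)=\int\varphi(t)\mathcal{E}(t)dt$ and $\mathbb{E}\,\mathcal{E}(t)\mathcal{E}(s)=\sigma^2\delta(t-s)$. For a kernel $K\in L^1(\mathbb{R})$, the expression $X(t)=\int K(x)\mathcal{E}(t+x)\,dx$ denotes the generalized process $X(\varphi)=\mathcal{E}(K*\varphi)$, $\varphi\in L^2(\mathbb{R})$. In an iterated integral such as the one in the claim, $K$ is the function obtained by carrying out the other integration. Meaning of solution: with $A=(-1)^n\frac{d^{2n}}{dt^{2n}}$, a solution of $(\mu+A)^\beta X=\mathcal{E}$ is $X=(\mu+A)^{-\beta}\mathcal{E}$, where $$(\mu+A)^{-\beta}=\frac{1}{\Gamma(\beta)}\int_0^\infty w^{\beta-1}e^{-\mu w}e^{-wA}\,dw$$ and $(e^{-wA})_{w\ge 0}$ is the semigroup generated by $-A$ on $L^2(\mathbb{R})$.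 A bounded operator $T$ on $L^2(\mathbb{R})$ acts on $\mathcal{E}$ by duality, $(T\mathcal{E})(\varphi)=\mathcal{E}(T^*\varphi)$. Covariance function: $\mathrm{Cov}_X(h)=\mathbb{E}[X(t+h)X(t)]$, where $\mathbb{E}X(t)=0$. For generalized processes this means that $\mathrm{Cov}_X$ is the integrable function on $\mathbb{R}$ with $\mathbb{E}[X(\varphi)X(\psi)]=\int\int\mathrm{Cov}_X(t-s)\varphi(t)\psi(s)\,dt\,ds$ for all $\varphi,\psi\in L^2(\mathbb{R})$; formulas for $\mathrm{Cov}_X$ are identities between such functions (almost everywhere in $h$). *)

theory Defs
  imports "HOL-Probability.Probability"
begin

section \<open>The real Hilbert space of square-integrable functions\<close>

text \<open>Elements of $L^2(\mathbb{R})$ are represented by Borel functions; identities between them are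
  understood almost everywhere.\<close>

definition L2_space :: "(real \<Rightarrow> real) set" where
  "L2_space = {f \<in> borel_measurable borel. integrable lborel (\<lambda>x. (f x)\<^sup>2)}"

definition L2_inner :: "(real \<Rightarrow> real) \<Rightarrow> (real \<Rightarrow> real) \<Rightarrow> real" where
  "L2_inner f g = (\<integral>x. f x * g x \<partial>lborel)"

definition L2_norm :: "(real \<Rightarrow> real) \<Rightarrow> real" where
  "L2_norm f = sqrt (L2_inner f f)"

text \<open>Linearity and boundedness together make such a map respect almost-everywhere equality.\<close>

definition bounded_L2_operator :: "((real \<Rightarrow> real) \<Rightarrow> real \<Rightarrow> real) \<Rightarrow> bool" where
  "bounded_L2_operator T \<longleftrightarrow>
     (\<forall>f\<in>L2_space. T f \<in> L2_space) \<and>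
     (\<forall>f\<in>L2_space. \<forall>g\<in>L2_space. \<forall>a b.
        AE x in lborel. T (\<lambda>y. a * f y + b * g y) x = a * T f x + b * T g x) \<and>
     (\<exists>C. \<forall>f\<in>L2_space. L2_norm (T f) \<le> C * L2_norm f)"

definition L2_adjoint ::
  "((real \<Rightarrow> real) \<Rightarrow> real \<Rightarrow> real) \<Rightarrow> ((real \<Rightarrow> real) \<Rightarrow> real \<Rightarrow> real) \<Rightarrow> bool" where
  "L2_adjoint T T' \<longleftrightarrow>
     (\<forall>f\<in>L2_space. T' f \<in> L2_space) \<and>
     (\<forall>f\<in>L2_space. \<forall>g\<in>L2_space. L2_inner (T' f) g = L2_inner f (T g))"

section \<open>Test functions, fundamental solution, and the operator $A$\<close>

definition test_function :: "(real \<Rightarrow> real) \<Rightarrow> bool" where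
  "test_function \<psi> \<longleftrightarrow>
     (\<forall>k x. (deriv ^^ k) \<psi> differentiable at x) \<and> (\<exists>R. \<forall>x. \<bar>x\<bar> > R \<longrightarrow> \<psi> x = 0)"

text \<open>\<open>u x w\<close> is the fundamental solution of the heat equation of order \<open>2 * n\<close>. The partial
  differential equation and the initial datum alone do not determine it without a growth condition;
  the Fourier transform singles it out. For \<open>w \<le> 0\<close> the function carries no
  meaning and is extended by zero.\<close>

definition fundamental_solution :: "nat \<Rightarrow> (real \<Rightarrow> real \<Rightarrow> real) \<Rightarrow> bool" where
  "fundamental_solution n u \<longleftrightarrow>
     (\<forall>x. \<forall>w>0.
        (\<forall>k<2 * n. (deriv ^^ k) (\<lambda>y. u y w) differentiable at x) \<and>
        ((\<lambda>v. u x v) has_real_derivative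
           (- 1) ^ (n + 1) * (deriv ^^ (2 * n)) (\<lambda>y. u y w) x) (at w)) \<and>
     (\<forall>\<psi>. test_function \<psi> \<longrightarrow>
        ((\<lambda>w. \<integral>x. u x w * \<psi> x \<partial>lborel) \<longlongrightarrow> \<psi> 0) (at_right 0)) \<and>
     (\<forall>w>0. integrable lborel (\<lambda>x. u x w) \<and>
        (\<forall>\<xi>. (\<integral>x. iexp (\<xi> * x) * complex_of_real (u x w) \<partial>lborel)
              = complex_of_real (exp (- (\<xi> ^ (2 * n)) * w)))) \<and>
     (\<forall>x. \<forall>w\<le>0. u x w = 0)"

text \<open>The graph of $A = (-1)^n d^{2n}/dt^{2n}$ on its maximal domain, the square-integrable functions
  whose distributional derivative of order \<open>2 * n\<close> is square-integrable (the Sobolev space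
  $H^{2n}(\mathbb{R})$). The order is even, so moving the derivative to the test function costs
  no sign.\<close>

definition heat_operator :: "nat \<Rightarrow> (real \<Rightarrow> real) \<Rightarrow> (real \<Rightarrow> real) \<Rightarrow> bool" where
  "heat_operator n f g \<longleftrightarrow> f \<in> L2_space \<and> g \<in> L2_space \<and>
     (\<forall>\<psi>. test_function \<psi> \<longrightarrow>
        L2_inner g \<psi> = (- 1) ^ n * L2_inner f ((deriv ^^ (2 * n)) \<psi>))"

section \<open>Semigroups and negative fractional powers\<close>

definition C0_semigroup :: "(real \<Rightarrow> (real \<Rightarrow> real) \<Rightarrow> real \<Rightarrow> real) \<Rightarrow> bool" where
  "C0_semigroup S \<longleftrightarrow>
     (\<forall>w\<ge>0. bounded_L2_operator (S w)) \<and>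
     (\<forall>f\<in>L2_space. AE x in lborel. S 0 f x = f x) \<and>
     (\<forall>v\<ge>0. \<forall>w\<ge>0. \<forall>f\<in>L2_space. AE x in lborel. S (v + w) f x = S v (S w f) x) \<and>
     (\<forall>f\<in>L2_space. ((\<lambda>w. L2_norm (\<lambda>x. S w f x - f x)) \<longlongrightarrow> 0) (at_right 0))"

definition semigroup_generator ::
  "(real \<Rightarrow> (real \<Rightarrow> real) \<Rightarrow> real \<Rightarrow> real) \<Rightarrow> (real \<Rightarrow> real) \<Rightarrow> (real \<Rightarrow> real) \<Rightarrow> bool" where
  "semigroup_generator S f g \<longleftrightarrow> f \<in> L2_space \<and> g \<in> L2_space \<and>
     ((\<lambda>w. L2_norm (\<lambda>x. (S w f x - f x) / w - g x)) \<longlongrightarrow> 0) (at_right 0)"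

definition generated_by_minus_heat_operator ::
  "nat \<Rightarrow> (real \<Rightarrow> (real \<Rightarrow> real) \<Rightarrow> real \<Rightarrow> real) \<Rightarrow> bool" where
  "generated_by_minus_heat_operator n S \<longleftrightarrow> C0_semigroup S \<and>
     (\<forall>f g. semigroup_generator S f g \<longleftrightarrow> heat_operator n f (\<lambda>x. - g x))"

text \<open>\<open>T\<close> is $\frac{1}{\Gamma(\beta)} \int_0^\infty w^{\beta-1} e^{-\mu w} S_w \, dw$. The
  operator-valued integral is the weak (Pettis) one, that is, it is evaluated after pairing with
  arbitrary elements of $L^2(\mathbb{R})$.\<close>

definition negative_fractional_power ::
  "(real \<Rightarrow> (real \<Rightarrow> real) \<Rightarrow> real \<Rightarrow> real) \<Rightarrow> real \<Rightarrow> real \<Rightarrow>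
   ((real \<Rightarrow> real) \<Rightarrow> real \<Rightarrow> real) \<Rightarrow> bool" where
  "negative_fractional_power S \<mu> \<beta> T \<longleftrightarrow> bounded_L2_operator T \<and>
     (\<forall>f\<in>L2_space. \<forall>g\<in>L2_space.
        set_integrable lborel {0<..}
          (\<lambda>w. w powr (\<beta> - 1) * exp (- \<mu> * w) * L2_inner (S w f) g) \<and>
        L2_inner (T f) g = 1 / Gamma \<beta> *
          (LINT w:{0<..}|lborel. w powr (\<beta> - 1) * exp (- \<mu> * w) * L2_inner (S w f) g))"

section \<open>White noise and generalized processes\<close>

text \<open>The constant \<open>0\<close> is the Gaussian variable of variance zero.\<close>

definition centered_gaussian :: "'a measure \<Rightarrow> ('a \<Rightarrow> real) \<Rightarrow> bool" where
  "centered_gaussian M Y \<longleftrightarrow> Y \<in> borel_measurable M \<and>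
     ((AE \<omega> in M. Y \<omega> = 0) \<or> (\<exists>s>0. distributed M lborel Y (normal_density 0 s)))"

text \<open>By linearity every finite linear combination of the variables \<open>\<E> \<phi>\<close> is again one of them,
  so the condition on single variables makes the whole family jointly Gaussian.\<close>

definition white_noise :: "'a measure \<Rightarrow> real \<Rightarrow> ((real \<Rightarrow> real) \<Rightarrow> 'a \<Rightarrow> real) \<Rightarrow> bool" where
  "white_noise M \<sigma> \<E> \<longleftrightarrow> prob_space M \<and>
     (\<forall>\<phi>\<in>L2_space. centered_gaussian M (\<E> \<phi>)) \<and>
     (\<forall>\<phi>\<in>L2_space. \<forall>\<psi>\<in>L2_space. \<forall>a b.
        AE \<omega> in M. \<E> (\<lambda>t. a * \<phi> t + b * \<psi> t) \<omega> = a * \<E> \<phi> \<omega> + b * \<E> \<psi> \<omega>) \<and>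
     (\<forall>\<phi>\<in>L2_space. \<forall>\<psi>\<in>L2_space.
        prob_space.expectation M (\<lambda>\<omega>. \<E> \<phi> \<omega> * \<E> \<psi> \<omega>) = \<sigma>\<^sup>2 * L2_inner \<phi> \<psi>)"

definition fun_convolution :: "(real \<Rightarrow> real) \<Rightarrow> (real \<Rightarrow> real) \<Rightarrow> real \<Rightarrow> real" where
  "fun_convolution K \<phi> s = (\<integral>x. K x * \<phi> (s - x) \<partial>lborel)"

text \<open>The generalized process denoted by $X(t) = \int K(x) \mathcal{E}(t + x) \, dx$.\<close>

definition kernel_process ::
  "((real \<Rightarrow> real) \<Rightarrow> 'a \<Rightarrow> real) \<Rightarrow> (real \<Rightarrow> real) \<Rightarrow> (real \<Rightarrow> real) \<Rightarrow> 'a \<Rightarrow> real" where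
  "kernel_process \<E> K \<phi> = \<E> (fun_convolution K \<phi>)"

text \<open>\<open>X\<close> is $(\mu + A)^{-\beta} \mathcal{E}$, with operators acting on noise by duality.\<close>

definition fractional_solution ::
  "'a measure \<Rightarrow> ((real \<Rightarrow> real) \<Rightarrow> 'a \<Rightarrow> real) \<Rightarrow> nat \<Rightarrow> real \<Rightarrow> real \<Rightarrow>
   ((real \<Rightarrow> real) \<Rightarrow> 'a \<Rightarrow> real) \<Rightarrow> bool" where
  "fractional_solution M \<E> n \<mu> \<beta> X \<longleftrightarrow>
     (\<exists>S T T'. generated_by_minus_heat_operator n S \<and>
        negative_fractional_power S \<mu> \<beta> T \<and> L2_adjoint T T' \<and>
        (\<forall>\<phi>\<in>L2_space. AE \<omega> in M. X \<phi> \<omega> = \<E> (T' \<phi>) \<omega>))"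

definition covariance_function ::
  "'a measure \<Rightarrow> ((real \<Rightarrow> real) \<Rightarrow> 'a \<Rightarrow> real) \<Rightarrow> (real \<Rightarrow> real) \<Rightarrow> bool" where
  "covariance_function M X C \<longleftrightarrow> integrable lborel C \<and>
     (\<forall>\<phi>\<in>L2_space. integrable M (X \<phi>) \<and> prob_space.expectation M (X \<phi>) = 0) \<and>
     (\<forall>\<phi>\<in>L2_space. \<forall>\<psi>\<in>L2_space.
        integrable M (\<lambda>\<omega>. X \<phi> \<omega> * X \<psi> \<omega>) \<and>
        prob_space.expectation M (\<lambda>\<omega>. X \<phi> \<omega> * X \<psi> \<omega>) =
          (\<integral>t. (\<integral>s. C (t - s) * \<phi> t * \<psi> s \<partial>lborel) \<partial>lborel))"

definition spectral_function :: "(real \<Rightarrow> real) \<Rightarrow> real \<Rightarrow> complex" where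
  "spectral_function C \<tau> = (\<integral>h. iexp (\<tau> * h) * complex_of_real (C h) \<partial>lborel)"

definition gamma_density :: "real \<Rightarrow> real \<Rightarrow> real \<Rightarrow> real" where
  "gamma_density a r w =
     (if w > 0 then r powr a / Gamma a * w powr (a - 1) * exp (- r * w) else 0)"

end

theory Submission
  imports Defs "HOL-Computational_Algebra.Polynomial"
begin

text \<open>On the Fourier side everything is multiplication. The function $u_{2n}(\cdot, w)$ has transform
  $e^{-\xi^{2n} w}$, so $e^{-wA}$ is convolution with it; averaging over \<open>w\<close> with the weight
  $w^{\beta-1} e^{-\mu w} / \Gamma(\beta)$ gives an even kernel \<open>K\<close> with transform $(\mu + \xi^{2n})^{-\beta}$;
  and the process driven by \<open>K\<close> has covariance $\sigma^2 (K * K)$, whose transform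
  $\sigma^2 (\mu + \xi^{2n})^{-2\beta}$ is that of the average with shape $2\beta$.

  The Fourier transform is injective on integrable functions (\<open>fourier_injective\<close>, a consequence of
  Levy's uniqueness theorem), which turns identities between transforms into identities between
  kernels. Statements about $L^2$ are reached from the formula
  $\langle k * f, g \rangle = \int k(y) \langle f(\cdot - y), g \rangle \, dy$ (\<open>L2_inner_fun_convolution\<close>): it
  reduces them to integrals of a kernel against a bounded function, which is continuous at the origin when
  \<open>f = g\<close>.

  Uniqueness also gives the self-similarity $u(x, w) = w^{-1/2n} u(x w^{-1/2n}, 1)$ (\<open>u_scaling\<close>). Hence
  \<open>u\<close> is jointly measurable, its $L^1$ norm in \<open>x\<close> does not depend on \<open>w\<close>, Fubini's theorem applies to
  all time averages, and strong continuity of the semigroup is the approximate identity theorem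
  (\<open>approximate_identity\<close>).

  The generator is the delicate part, since $A$ is given on its maximal domain by weak derivatives. For a test
  function, comparison of transforms shows
  $(e^{-wA} \psi - \psi) / w = - m_w * A \psi$, where $m_w$ is the mean of \<open>u\<close> over the times in $[0, w]$
  (\<open>heat_difference_test_function\<close>). Pairing with \<open>f\<close> and letting \<open>w\<close> tend to zero shows that the generator
  is contained in $-A$. Conversely, let $-A f = g$ weakly. Weak derivatives commute with convolution, so pairing with
  test functions shows $(e^{-wA} f - f) / w = m_w * g$, and this converges to \<open>g\<close> because the $m_w$ are
  dilations of one kernel with integral one.

  The covariance function is unique because the convolution with a Gaussian, whose transform has no zeros, is
  injective on integrable functions.\<close>

section \<open>Square-integrable functions\<close>

lemma L2_space_borel: "f \<in> L2_space \<Longrightarrow> f \<in> borel_measurable borel"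
  by (simp add: L2_space_def)

lemma L2_space_square_integrable: "f \<in> L2_space \<Longrightarrow> integrable lborel (\<lambda>x. (f x)\<^sup>2)"
  by (simp add: L2_space_def)

lemma abs_mult_le_squares: "\<bar>a * b\<bar> \<le> a\<^sup>2 + b\<^sup>2" for a b :: real
proof -
  have "2 * \<bar>a\<bar> * \<bar>b\<bar> \<le> \<bar>a\<bar>\<^sup>2 + \<bar>b\<bar>\<^sup>2"
    by (rule sum_squares_bound)
  moreover have "0 \<le> \<bar>a\<bar> * \<bar>b\<bar>" by simp
  ultimately have "\<bar>a\<bar> * \<bar>b\<bar> \<le> \<bar>a\<bar>\<^sup>2 + \<bar>b\<bar>\<^sup>2" by linarith
  then show ?thesis by (simp add: abs_mult)
qed

lemma L2_mult_integrable:
  assumes "f \<in> L2_space" "g \<in> L2_space"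
  shows "integrable lborel (\<lambda>x. f x * g x)"
proof (rule Bochner_Integration.integrable_bound)
  show "integrable lborel (\<lambda>x. (f x)\<^sup>2 + (g x)\<^sup>2)"
    using assms by (simp add: L2_space_square_integrable)
  show "(\<lambda>x. f x * g x) \<in> borel_measurable lborel"
    using assms[THEN L2_space_borel] by simp
  show "AE x in lborel. norm (f x * g x) \<le> norm ((f x)\<^sup>2 + (g x)\<^sup>2)"
    using abs_mult_le_squares by (simp add: abs_le_iff)
qed

lemma L2_lincomb:
  assumes "f \<in> L2_space" "g \<in> L2_space"
  shows "(\<lambda>x. a * f x + b * g x) \<in> L2_space"
proof -
  have "(\<lambda>x. (a * f x + b * g x)\<^sup>2) =
      (\<lambda>x. a\<^sup>2 * (f x)\<^sup>2 + 2 * a * b * (f x * g x) + b\<^sup>2 * (g x)\<^sup>2)"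
    by (auto simp: power2_eq_square algebra_simps)
  moreover have "integrable lborel (\<lambda>x. a\<^sup>2 * (f x)\<^sup>2 + 2 * a * b * (f x * g x) + b\<^sup>2 * (g x)\<^sup>2)"
    using assms L2_space_square_integrable L2_mult_integrable by (intro Bochner_Integration.integrable_add) auto
  ultimately show ?thesis
    using assms[THEN L2_space_borel] by (simp add: L2_space_def)
qed

lemma L2_diff: "f \<in> L2_space \<Longrightarrow> g \<in> L2_space \<Longrightarrow> (\<lambda>x. f x - g x) \<in> L2_space"
  using L2_lincomb[of f g 1 "-1"] by simp

lemma L2_scale: "f \<in> L2_space \<Longrightarrow> (\<lambda>x. a * f x) \<in> L2_space"
  using L2_lincomb[of f f a 0] by simp

lemma L2_minus: "f \<in> L2_space \<Longrightarrow> (\<lambda>x. - f x) \<in> L2_space"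
  using L2_scale[of f "-1"] by simp

lemma L2_abs: "f \<in> L2_space \<Longrightarrow> (\<lambda>x. \<bar>f x\<bar>) \<in> L2_space"
  by (auto simp: L2_space_def)

lemma L2_inner_lincomb_left:
  assumes "f \<in> L2_space" "g \<in> L2_space" "h \<in> L2_space"
  shows "L2_inner (\<lambda>x. a * f x + b * g x) h = a * L2_inner f h + b * L2_inner g h"
proof -
  have "L2_inner (\<lambda>x. a * f x + b * g x) h = (\<integral>x. a * (f x * h x) + b * (g x * h x) \<partial>lborel)"
    unfolding L2_inner_def by (intro Bochner_Integration.integral_cong) (auto simp: algebra_simps)
  also have "\<dots> = a * L2_inner f h + b * L2_inner g h"
    using assms L2_mult_integrable unfolding L2_inner_def by simp
  finally show ?thesis .
qed

lemma L2_inner_commute: "L2_inner f g = L2_inner g f"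
  by (simp add: L2_inner_def mult.commute)

lemma L2_inner_diff_left:
  "f \<in> L2_space \<Longrightarrow> g \<in> L2_space \<Longrightarrow> h \<in> L2_space \<Longrightarrow>
    L2_inner (\<lambda>x. f x - g x) h = L2_inner f h - L2_inner g h"
  using L2_inner_lincomb_left[of f g h 1 "-1"] by simp

lemma L2_inner_scale_left: "L2_inner (\<lambda>x. a * f x) h = a * L2_inner f h"
  by (simp add: L2_inner_def mult.assoc)

lemma L2_inner_minus_left: "L2_inner (\<lambda>x. - f x) h = - L2_inner f h"
  by (simp add: L2_inner_def)

lemma L2_inner_cong_AE:
  assumes "f \<in> L2_space" "f' \<in> borel_measurable borel" "g \<in> L2_space" "AE x in lborel. f x = f' x"
  shows "L2_inner f g = L2_inner f' g"
  unfolding L2_inner_def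
  using assms(4) by (intro integral_cong_AE) (use assms(1-3)[unfolded L2_space_def] in \<open>auto elim: eventually_mono\<close>)

lemma L2_inner_self_nonneg: "0 \<le> L2_inner f f"
  by (simp add: L2_inner_def integral_nonneg_AE)

lemma L2_norm_nonneg: "0 \<le> L2_norm f"
  by (simp add: L2_norm_def L2_inner_self_nonneg)

lemma L2_norm_square: "(L2_norm f)\<^sup>2 = L2_inner f f"
  by (simp add: L2_norm_def L2_inner_self_nonneg)

lemma L2_norm_cong_AE:
  assumes "f \<in> borel_measurable borel" "g \<in> borel_measurable borel" "AE x in lborel. f x = g x"
  shows "L2_norm f = L2_norm g"
proof -
  have "L2_inner f f = L2_inner g g"
    unfolding L2_inner_def using assms by (intro integral_cong_AE) (auto elim: eventually_mono)
  then show ?thesis by (simp add: L2_norm_def)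
qed

lemma L2_inner_Cauchy_Schwarz:
  assumes f: "f \<in> L2_space" and g: "g \<in> L2_space"
  shows "\<bar>L2_inner f g\<bar> \<le> L2_norm f * L2_norm g"
proof -
  define a b c where "a = L2_inner g g" and "b = L2_inner f g" and "c = L2_inner f f"
  have quad: "0 \<le> s\<^sup>2 * c + 2 * s * t * b + t\<^sup>2 * a" for s t
  proof -
    let ?h = "\<lambda>x. s * f x + t * g x"
    have h: "?h \<in> L2_space" using f g by (rule L2_lincomb)
    have "L2_inner ?h ?h = s * L2_inner f ?h + t * L2_inner g ?h"
      by (rule L2_inner_lincomb_left[OF f g h])
    also have "\<dots> = s * L2_inner ?h f + t * L2_inner ?h g"
      by (simp add: L2_inner_commute)
    also have "\<dots> = s\<^sup>2 * c + 2 * s * t * b + t\<^sup>2 * a"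
      unfolding L2_inner_lincomb_left[OF f g f] L2_inner_lincomb_left[OF f g g] a_def b_def c_def
      by (simp add: power2_eq_square algebra_simps L2_inner_commute[of g f])
    finally show ?thesis using L2_inner_self_nonneg[of ?h] by simp
  qed
  have a0: "0 \<le> a" and c0: "0 \<le> c" by (simp_all add: a_def c_def L2_inner_self_nonneg)
  have "b\<^sup>2 \<le> c * a"
  proof (cases "a = 0")
    case False
    \<comment> \<open>The minimum of the form on the line \<open>s = a\<close>.\<close>
    have "0 \<le> a\<^sup>2 * c + 2 * a * (- b) * b + (- b)\<^sup>2 * a" by (rule quad)
    then have "a * b\<^sup>2 \<le> a * (c * a)" by (simp add: power2_eq_square algebra_simps)
    then show ?thesis using False a0 by (simp add: mult_le_cancel_left_pos)
  next
    case True
    have "b = 0"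
    proof (rule ccontr)
      assume "b \<noteq> 0"
      \<comment> \<open>If \<open>a = 0\<close> the form is affine in the second variable; this choice makes it negative.\<close>
      have "0 \<le> 1\<^sup>2 * c + 2 * 1 * (- (c + 1) / b) * b + (- (c + 1) / b)\<^sup>2 * a" by (rule quad)
      then show False using \<open>b \<noteq> 0\<close> True c0 by simp
    qed
    then show ?thesis using True by simp
  qed
  then have "sqrt (b\<^sup>2) \<le> sqrt (c * a)" by (rule real_sqrt_le_mono)
  then show ?thesis
    by (simp add: L2_norm_def real_sqrt_mult a_def b_def c_def)
qed

lemma L2_norm_zero_imp_AE:
  assumes "f \<in> L2_space" "L2_norm f = 0"
  shows "AE x in lborel. f x = 0"
proof -
  have "(\<integral>x. (f x)\<^sup>2 \<partial>lborel) = 0"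
    using assms(2) by (simp add: L2_norm_def L2_inner_def power2_eq_square)
  then have "AE x in lborel. (f x)\<^sup>2 = 0"
    using integral_nonneg_eq_0_iff_AE[OF L2_space_square_integrable[OF assms(1)]] by simp
  then show ?thesis by simp
qed

text \<open>Square-integrable functions are identified by their pairings: test with their difference.\<close>

lemma L2_AE_eqI:
  assumes f: "f \<in> L2_space" and g: "g \<in> L2_space"
    and eq: "\<And>h. h \<in> L2_space \<Longrightarrow> L2_inner f h = L2_inner g h"
  shows "AE x in lborel. f x = g x"
proof -
  let ?d = "\<lambda>x. f x - g x"
  have d: "?d \<in> L2_space" using f g by (rule L2_diff)
  have "L2_inner ?d ?d = 0" using L2_inner_diff_left[OF f g d] eq[OF d] by simp
  then have "AE x in lborel. ?d x = 0" using L2_norm_zero_imp_AE[OF d] by (simp add: L2_norm_def)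
  then show ?thesis by simp
qed

lemma L2_norm_minus: "L2_norm (\<lambda>x. - f x) = L2_norm f"
  by (simp add: L2_norm_def L2_inner_def)

lemma L2_norm_diff_square:
  assumes f: "f \<in> L2_space" and g: "g \<in> L2_space"
  shows "(L2_norm (\<lambda>x. f x - g x))\<^sup>2 = L2_inner f f - 2 * L2_inner f g + L2_inner g g"
proof -
  let ?d = "\<lambda>x. f x - g x"
  have d: "?d \<in> L2_space" using f g by (rule L2_diff)
  show ?thesis
    unfolding L2_norm_square L2_inner_diff_left[OF f g d]
      L2_inner_commute[of f ?d] L2_inner_commute[of g ?d]
      L2_inner_diff_left[OF f g f] L2_inner_diff_left[OF f g g]
    by (simp add: L2_inner_commute[of g f])
qed

lemma L2_norm_triangle_diff:
  assumes f: "f \<in> L2_space" and g: "g \<in> L2_space" and h: "h \<in> L2_space"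
  shows "L2_norm (\<lambda>x. f x - h x) \<le> L2_norm (\<lambda>x. f x - g x) + L2_norm (\<lambda>x. g x - h x)"
proof -
  let ?a = "\<lambda>x. f x - g x" and ?b = "\<lambda>x. h x - g x"
  have a: "?a \<in> L2_space" and b: "?b \<in> L2_space" using f g h by (auto intro: L2_diff)
  have b': "L2_norm (\<lambda>x. g x - h x) = L2_norm ?b" using L2_norm_minus[of ?b] by simp
  have "(L2_norm (\<lambda>x. f x - h x))\<^sup>2 = (L2_norm (\<lambda>x. ?a x - ?b x))\<^sup>2" by simp
  also have "\<dots> = (L2_norm ?a)\<^sup>2 - 2 * L2_inner ?a ?b + (L2_norm ?b)\<^sup>2"
    by (simp only: L2_norm_diff_square[OF a b] L2_norm_square)
  also have "\<dots> \<le> (L2_norm ?a)\<^sup>2 + 2 * (L2_norm ?a * L2_norm ?b) + (L2_norm ?b)\<^sup>2"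
    using L2_inner_Cauchy_Schwarz[OF a b] by simp
  also have "\<dots> = (L2_norm ?a + L2_norm ?b)\<^sup>2" by (simp add: power2_eq_square algebra_simps)
  finally show ?thesis unfolding b' by (rule power2_le_imp_le) (simp add: L2_norm_nonneg)
qed

lemma L2_inner_tendsto:
  assumes "\<And>w. F w \<in> L2_space" "f \<in> L2_space" "g \<in> L2_space"
    and "((\<lambda>w. L2_norm (\<lambda>x. F w x - f x)) \<longlongrightarrow> 0) A"
  shows "((\<lambda>w. L2_inner (F w) g) \<longlongrightarrow> L2_inner f g) A"
proof -
  have "((\<lambda>w. L2_inner (F w) g - L2_inner f g) \<longlongrightarrow> 0) A"
  proof (rule Lim_null_comparison)
    show "\<forall>\<^sub>F w in A. norm (L2_inner (F w) g - L2_inner f g) \<le> L2_norm (\<lambda>x. F w x - f x) * L2_norm g"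
      using L2_inner_Cauchy_Schwarz[OF L2_diff[OF assms(1,2)] assms(3)]
      by (intro always_eventually) (simp add: L2_inner_diff_left assms)
    show "((\<lambda>w. L2_norm (\<lambda>x. F w x - f x) * L2_norm g) \<longlongrightarrow> 0) A"
      using assms(4) by (rule tendsto_mult_left_zero)
  qed
  then show ?thesis by (rule LIM_zero_cancel)
qed

section \<open>Translations and correlations\<close>

lemma L2_shift:
  assumes "f \<in> L2_space"
  shows "(\<lambda>x. f (x - y)) \<in> L2_space"
proof -
  have "integrable lborel (\<lambda>x. (f (- y + 1 * x))\<^sup>2)"
    using lborel_integrable_real_affine[of "\<lambda>x. (f x)\<^sup>2" 1 "-y"] L2_space_square_integrable[OF assms]
    by simp
  moreover have [measurable]: "f \<in> borel_measurable borel" using assms by (rule L2_space_borel)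
  have "(\<lambda>x. f (x - y)) \<in> borel_measurable borel" by measurable
  ultimately show ?thesis by (simp add: L2_space_def)
qed

lemma lborel_integral_shift: "(\<integral>x. f (x - y) \<partial>lborel) = (\<integral>x. f x \<partial>lborel)"
  for f :: "real \<Rightarrow> 'a :: {banach, second_countable_topology}"
  using lborel_integral_real_affine[of 1 f "-y"] by simp

lemma lborel_integral_reflect: "(\<integral>x. f (y - x) \<partial>lborel) = (\<integral>x. f x \<partial>lborel)"
  for f :: "real \<Rightarrow> 'a :: {banach, second_countable_topology}"
  using lborel_integral_real_affine[of "-1" f y] by simp

lemma L2_norm_shift: "L2_norm (\<lambda>x. f (x - y)) = L2_norm f"
  using lborel_integral_shift[of "\<lambda>x. f x * f x" y] by (simp add: L2_norm_def L2_inner_def)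

lemma L2_inner_shift_move: "L2_inner (\<lambda>x. f (x - y)) g = L2_inner f (\<lambda>x. g (x + y))"
  using lborel_integral_shift[of "\<lambda>x. f (x - y) * g x" "-y"] by (simp add: L2_inner_def)

text \<open>Every pairing of a convolution with an element of $L^2$ is an integral of the kernel against this
  function, which is bounded by the Cauchy-Schwarz inequality and, on the diagonal \<open>f = g\<close>,
  continuous at the origin.\<close>

definition correlation :: "(real \<Rightarrow> real) \<Rightarrow> (real \<Rightarrow> real) \<Rightarrow> real \<Rightarrow> real" where
  "correlation f g y = L2_inner (\<lambda>x. f (x - y)) g"

lemma correlation_zero: "correlation f g 0 = L2_inner f g"
  by (simp add: correlation_def)

lemma correlation_bound:
  "f \<in> L2_space \<Longrightarrow> g \<in> L2_space \<Longrightarrow> \<bar>correlation f g y\<bar> \<le> L2_norm f * L2_norm g"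
  unfolding correlation_def using L2_inner_Cauchy_Schwarz[OF L2_shift] by (simp add: L2_norm_shift)

lemma correlation_measurable:
  assumes "f \<in> borel_measurable borel" "g \<in> borel_measurable borel"
  shows "correlation f g \<in> borel_measurable borel"
proof -
  note [measurable] = assms
  have "(\<lambda>y. \<integral>x. f (x - y) * g x \<partial>lborel) \<in> borel_measurable borel"
    by measurable
  then show ?thesis by (simp add: correlation_def L2_inner_def fun_eq_iff cong: measurable_cong)
qed

lemma correlation_shift_right:
  "correlation f (\<lambda>x. g (x - z)) y = correlation f g (y - z)"
  using lborel_integral_shift[of "\<lambda>x. f (x + z - y) * g x" z]
  by (simp add: correlation_def L2_inner_def algebra_simps)

lemma correlation_commute: "correlation f g y = correlation g f (- y)"
  unfolding correlation_def
  by (subst L2_inner_shift_move) (simp add: L2_inner_commute)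

section \<open>Convolution with an integrable kernel\<close>

lemma integrable_borel: "integrable lborel k \<Longrightarrow> k \<in> borel_measurable borel"
  for k :: "real \<Rightarrow> 'a :: {banach, second_countable_topology}"
  using borel_measurable_integrable by fastforce

lemma integrable_convolution_pair:
  fixes k :: "real \<Rightarrow> real" and l :: "real \<Rightarrow> real"
  assumes k: "integrable lborel k" and l: "integrable lborel l"
  shows "integrable (lborel \<Otimes>\<^sub>M lborel) (\<lambda>(x, y). k y * l (x - y))"
proof -
  have [measurable]: "k \<in> borel_measurable borel" "l \<in> borel_measurable borel"
    using k l borel_measurable_integrable by fastforce+
  have "integrable (lborel \<Otimes>\<^sub>M lborel) (\<lambda>(y, x). k y * l (x - y))"
  proof (rule lborel_pair.Fubini_integrable)
    show "(\<lambda>(y, x). k y * l (x - y)) \<in> borel_measurable (lborel \<Otimes>\<^sub>M lborel)" by measurable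
    have "(\<integral>x. norm (k y * l (x - y)) \<partial>lborel) = \<bar>k y\<bar> * (\<integral>x. \<bar>l x\<bar> \<partial>lborel)" for y
      using lborel_integral_shift[of "\<lambda>x. \<bar>l x\<bar>" y] by (simp add: abs_mult)
    then show "integrable lborel (\<lambda>y. \<integral>x. norm (case (y, x) of (y, x) \<Rightarrow> k y * l (x - y)) \<partial>lborel)"
      using k by simp
    have "integrable lborel (\<lambda>x. l (x - y))" for y
      using lborel_integrable_real_affine[OF l, of 1 "-y"] by simp
    then show "AE y in lborel. integrable lborel (\<lambda>x. case (y, x) of (y, x) \<Rightarrow> k y * l (x - y))"
      by simp
  qed
  from lborel_pair.integrable_product_swap[OF this] show ?thesis by simp
qed

lemma fun_convolution_measurable:
  assumes "k \<in> borel_measurable borel" "f \<in> borel_measurable borel"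
  shows "fun_convolution k f \<in> borel_measurable borel"
proof -
  note [measurable] = assms
  have "(\<lambda>s. \<integral>x. k x * f (s - x) \<partial>lborel) \<in> borel_measurable borel" by measurable
  then show ?thesis by (simp add: fun_convolution_def fun_eq_iff cong: measurable_cong)
qed

lemma fun_convolution_integrable:
  assumes "integrable lborel k" "integrable lborel l"
  shows "integrable lborel (fun_convolution k l)"
  using lborel_pair.integrable_fst'[OF integrable_convolution_pair[OF assms]]
  by (simp add: fun_convolution_def[abs_def])

text \<open>Fubini's theorem and a translation. Characters \<open>c\<close> give the convolution theorem for the Fourier
  transform, correlations \<open>c\<close> give associativity of convolution acting on $L^2$.\<close>

lemma integral_fun_convolution:
  fixes c :: "real \<Rightarrow> 'a :: {banach, second_countable_topology}"
  assumes k: "integrable lborel k" and l: "integrable lborel l"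
    and c: "c \<in> borel_measurable borel" "\<And>x. norm (c x) \<le> B"
  shows "(\<integral>x. fun_convolution k l x *\<^sub>R c x \<partial>lborel)
       = (\<integral>y. k y *\<^sub>R (\<integral>z. l z *\<^sub>R c (y + z) \<partial>lborel) \<partial>lborel)"
proof -
  note [measurable] = integrable_borel[OF k] integrable_borel[OF l] c(1)
  have B: "0 \<le> B" using c(2)[of 0] norm_ge_zero order_trans by blast
  have int: "integrable (lborel \<Otimes>\<^sub>M lborel) (\<lambda>(x, y). (k y * l (x - y)) *\<^sub>R c x)"
  proof (rule Bochner_Integration.integrable_bound)
    show "integrable (lborel \<Otimes>\<^sub>M lborel) (\<lambda>p. B * (case p of (x, y) \<Rightarrow> k y * l (x - y)))"
      using integrable_convolution_pair[OF k l] by simp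
    show "(\<lambda>(x, y). (k y * l (x - y)) *\<^sub>R c x) \<in> borel_measurable (lborel \<Otimes>\<^sub>M lborel)"
      by measurable
    show "AE p in lborel \<Otimes>\<^sub>M lborel. norm (case p of (x, y) \<Rightarrow> (k y * l (x - y)) *\<^sub>R c x)
        \<le> norm (B * (case p of (x, y) \<Rightarrow> k y * l (x - y)))"
      using c(2) B by (auto simp: abs_mult mult.commute[of _ "norm _"] intro!: AE_I2 mult_right_mono)
  qed
  have "(\<integral>x. fun_convolution k l x *\<^sub>R c x \<partial>lborel)
      = (\<integral>x. (\<integral>y. (k y * l (x - y)) *\<^sub>R c x \<partial>lborel) \<partial>lborel)"
  proof (rule integral_cong_AE)
    from lborel_pair.AE_integrable_fst'[OF integrable_convolution_pair[OF k l]]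
    show "AE x in lborel. fun_convolution k l x *\<^sub>R c x = (\<integral>y. (k y * l (x - y)) *\<^sub>R c x \<partial>lborel)"
      by eventually_elim (simp add: fun_convolution_def)
  qed (use fun_convolution_measurable[of k l] in measurable)
  also have "\<dots> = (\<integral>y. (\<integral>x. (k y * l (x - y)) *\<^sub>R c x \<partial>lborel) \<partial>lborel)"
    using lborel_pair.Fubini_integral[OF int] by simp
  also have "\<dots> = (\<integral>y. k y *\<^sub>R (\<integral>z. l z *\<^sub>R c (y + z) \<partial>lborel) \<partial>lborel)"
  proof (rule Bochner_Integration.integral_cong)
    fix y :: real
    have "(\<integral>x. (k y * l (x - y)) *\<^sub>R c x \<partial>lborel) = (\<integral>x. k y *\<^sub>R (l (x - y) *\<^sub>R c (y + (x - y))) \<partial>lborel)"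
      by simp
    also have "\<dots> = (\<integral>z. k y *\<^sub>R (l z *\<^sub>R c (y + z)) \<partial>lborel)"
      by (rule lborel_integral_shift)
    also have "\<dots> = k y *\<^sub>R (\<integral>z. l z *\<^sub>R c (y + z) \<partial>lborel)"
      by (rule integral_scaleR_right)
    finally show "(\<integral>x. (k y * l (x - y)) *\<^sub>R c x \<partial>lborel) = k y *\<^sub>R (\<integral>z. l z *\<^sub>R c (y + z) \<partial>lborel)" .
  qed simp
  finally show ?thesis .
qed

text \<open>The second conjunct, from the convolution of the integrable functions $|k|$ and $f^2$, is what the
  proof of Young's inequality needs; it implies the first because $|f| \le 1 + f^2$.\<close>

lemma fun_convolution_AE_integrable:
  assumes k: "integrable lborel k" and f: "f \<in> L2_space"
  shows "AE x in lborel. integrable lborel (\<lambda>y. k y * f (x - y)) \<and>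
    integrable lborel (\<lambda>y. \<bar>k y\<bar> * (f (x - y))\<^sup>2)"
proof -
  note [measurable] = integrable_borel[OF k] L2_space_borel[OF f]
  have "AE x in lborel. integrable lborel (\<lambda>y. \<bar>k y\<bar> * (f (x - y))\<^sup>2)"
    using lborel_pair.AE_integrable_fst'[OF integrable_convolution_pair[of "\<lambda>y. \<bar>k y\<bar>" "\<lambda>x. (f x)\<^sup>2"]]
      k L2_space_square_integrable[OF f] by simp
  then show ?thesis
  proof eventually_elim
    case (elim x)
    have "integrable lborel (\<lambda>y. k y * f (x - y))"
    proof (rule Bochner_Integration.integrable_bound)
      show "integrable lborel (\<lambda>y. \<bar>k y\<bar> + \<bar>k y\<bar> * (f (x - y))\<^sup>2)"
        using k elim by simp
      have "\<bar>f (x - y)\<bar> \<le> 1 + (f (x - y))\<^sup>2" for y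
        using abs_mult_le_squares[of 1 "f (x - y)"] by simp
      then have "\<bar>k y\<bar> * \<bar>f (x - y)\<bar> \<le> \<bar>k y\<bar> * (1 + (f (x - y))\<^sup>2)" for y
        by (rule mult_left_mono) simp
      then show "AE y in lborel. norm (k y * f (x - y)) \<le> norm (\<bar>k y\<bar> + \<bar>k y\<bar> * (f (x - y))\<^sup>2)"
        by (simp add: abs_mult algebra_simps)
    qed measurable
    with elim show ?case by simp
  qed
qed

definition L1_norm :: "(real \<Rightarrow> real) \<Rightarrow> real" where
  "L1_norm k = (\<integral>x. \<bar>k x\<bar> \<partial>lborel)"

lemma L1_norm_nonneg: "0 \<le> L1_norm k"
  by (simp add: L1_norm_def)

text \<open>Young's inequality $L^1 * L^2 \subseteq L^2$. The Cauchy-Schwarz inequality with respect to the weight $|k|$ gives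
  $|k * f|^2 \le \|k\|_1 \, (|k| * f^2)$ pointwise, and the right-hand side is a convolution of integrable
  functions.\<close>

lemma fun_convolution_L2:
  assumes k: "integrable lborel k" and f: "f \<in> L2_space"
  shows "fun_convolution k f \<in> L2_space"
    and "L2_norm (fun_convolution k f) \<le> L1_norm k * L2_norm f"
proof -
  note [measurable] = integrable_borel[OF k] L2_space_borel[OF f]
  define F where "F = fun_convolution (\<lambda>y. \<bar>k y\<bar>) (\<lambda>x. (f x)\<^sup>2)"
  have F: "integrable lborel F"
    unfolding F_def using k L2_space_square_integrable[OF f] by (intro fun_convolution_integrable) auto
  have meas: "fun_convolution k f \<in> borel_measurable borel"
    by (rule fun_convolution_measurable) measurable
  have bound: "AE x in lborel. (fun_convolution k f x)\<^sup>2 \<le> L1_norm k * F x"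
    using fun_convolution_AE_integrable[OF k f]
  proof eventually_elim
    case (elim x)
    \<comment> \<open>The weight is shared evenly between the two factors.\<close>
    define a b where "a = (\<lambda>y. sqrt \<bar>k y\<bar>)" and "b = (\<lambda>y. sqrt \<bar>k y\<bar> * \<bar>f (x - y)\<bar>)"
    have [measurable]: "a \<in> borel_measurable borel" "b \<in> borel_measurable borel"
      unfolding a_def b_def by measurable
    have a: "a \<in> L2_space" using k by (simp add: L2_space_def a_def real_sqrt_abs2)
    have b: "b \<in> L2_space" using elim by (simp add: L2_space_def b_def power_mult_distrib)
    have ab: "a y * b y = \<bar>k y * f (x - y)\<bar>" for y
      by (simp add: a_def b_def abs_mult flip: mult.assoc)
    have "\<bar>fun_convolution k f x\<bar> \<le> (\<integral>y. \<bar>k y * f (x - y)\<bar> \<partial>lborel)"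
      unfolding fun_convolution_def by (rule integral_abs_bound)
    also have "\<dots> = L2_inner a b" by (simp add: L2_inner_def ab)
    also have "\<dots> \<le> L2_norm a * L2_norm b"
      using L2_inner_Cauchy_Schwarz[OF a b] by simp
    finally have "\<bar>fun_convolution k f x\<bar>\<^sup>2 \<le> (L2_norm a * L2_norm b)\<^sup>2"
      by (intro power_mono) auto
    also have "\<dots> = L2_inner a a * L2_inner b b"
      by (simp add: power_mult_distrib L2_norm_square)
    also have "L2_inner a a = L1_norm k"
      by (simp add: L2_inner_def L1_norm_def a_def)
    also have "L2_inner b b = F x"
      by (simp add: L2_inner_def F_def fun_convolution_def b_def flip: power2_eq_square)
        (simp add: power_mult_distrib)
    finally show ?case by simp
  qed
  have F0: "0 \<le> F x" for x
    unfolding F_def fun_convolution_def by simp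
  have sq: "integrable lborel (\<lambda>x. (fun_convolution k f x)\<^sup>2)"
  proof (rule Bochner_Integration.integrable_bound)
    show "integrable lborel (\<lambda>x. L1_norm k * F x)" using F by simp
    show "(\<lambda>x. (fun_convolution k f x)\<^sup>2) \<in> borel_measurable lborel" using meas by simp
    show "AE x in lborel. norm ((fun_convolution k f x)\<^sup>2) \<le> norm (L1_norm k * F x)"
      using bound by eventually_elim (use F0 L1_norm_nonneg in simp)
  qed
  then show L2: "fun_convolution k f \<in> L2_space" using meas by (simp add: L2_space_def)
  have intF: "(\<integral>x. F x \<partial>lborel) = L1_norm k * L2_inner f f"
  proof -
    have "(\<integral>x. F x *\<^sub>R (1::real) \<partial>lborel) =
        (\<integral>y. \<bar>k y\<bar> *\<^sub>R (\<integral>z. (f z)\<^sup>2 *\<^sub>R 1 \<partial>lborel) \<partial>lborel)"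
      unfolding F_def
      using k L2_space_square_integrable[OF f]
      by (intro integral_fun_convolution[where B = 1]) auto
    then show ?thesis by (simp add: L1_norm_def L2_inner_def power2_eq_square)
  qed
  have "(L2_norm (fun_convolution k f))\<^sup>2 = (\<integral>x. (fun_convolution k f x)\<^sup>2 \<partial>lborel)"
    unfolding L2_norm_square L2_inner_def by (simp add: power2_eq_square)
  also have "\<dots> \<le> (\<integral>x. L1_norm k * F x \<partial>lborel)"
    using bound sq F by (intro integral_mono_AE) auto
  also have "\<dots> = (L1_norm k * L2_norm f)\<^sup>2"
    by (simp add: intF power_mult_distrib L2_norm_square) (simp add: power2_eq_square)
  finally show "L2_norm (fun_convolution k f) \<le> L1_norm k * L2_norm f"
    by (rule power2_le_imp_le) (simp add: L1_norm_nonneg L2_norm_nonneg)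
qed

text \<open>The weak form of convolution, on which all later arguments about convolution operators rest: they
  reduce to integrals of kernels against bounded functions.\<close>

lemma L2_inner_fun_convolution:
  assumes k: "integrable lborel k" and f: "f \<in> L2_space" and g: "g \<in> L2_space"
  shows "L2_inner (fun_convolution k f) g = (\<integral>y. k y * correlation f g y \<partial>lborel)"
proof -
  note [measurable] = integrable_borel[OF k] L2_space_borel[OF f] L2_space_borel[OF g]
  have k': "integrable lborel (\<lambda>y. \<bar>k y\<bar>)" using k by simp
  have "integrable (lborel \<Otimes>\<^sub>M lborel) (\<lambda>(x, y). \<bar>k x\<bar> * (g y)\<^sup>2)"
  proof (rule lborel_pair.Fubini_integrable)
    show "integrable lborel (\<lambda>x. \<integral>y. norm (case (x, y) of (x, y) \<Rightarrow> \<bar>k x\<bar> * (g y)\<^sup>2) \<partial>lborel)"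
      using k by (simp add: abs_mult)
    show "AE x in lborel. integrable lborel (\<lambda>y. case (x, y) of (x, y) \<Rightarrow> \<bar>k x\<bar> * (g y)\<^sup>2)"
      using L2_space_square_integrable[OF g] by simp
  qed measurable
  from lborel_pair.integrable_product_swap[OF this]
  have kg: "integrable (lborel \<Otimes>\<^sub>M lborel) (\<lambda>(x, y). \<bar>k y\<bar> * (g x)\<^sup>2)" by simp
  have int: "integrable (lborel \<Otimes>\<^sub>M lborel) (\<lambda>(x, y). k y * f (x - y) * g x)"
  proof (rule Bochner_Integration.integrable_bound)
    show "integrable (lborel \<Otimes>\<^sub>M lborel) (\<lambda>p. (case p of (x, y) \<Rightarrow> \<bar>k y\<bar> * (f (x - y))\<^sup>2) +
        (case p of (x, y) \<Rightarrow> \<bar>k y\<bar> * (g x)\<^sup>2))"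
      using integrable_convolution_pair[OF k' L2_space_square_integrable[OF f]] kg
      by (rule Bochner_Integration.integrable_add)
    have "\<bar>k y\<bar> * \<bar>f (x - y) * g x\<bar> \<le> \<bar>k y\<bar> * ((f (x - y))\<^sup>2 + (g x)\<^sup>2)" for x y
      by (rule mult_left_mono[OF abs_mult_le_squares]) simp
    then show "AE p in lborel \<Otimes>\<^sub>M lborel. norm (case p of (x, y) \<Rightarrow> k y * f (x - y) * g x)
      \<le> norm ((case p of (x, y) \<Rightarrow> \<bar>k y\<bar> * (f (x - y))\<^sup>2) + (case p of (x, y) \<Rightarrow> \<bar>k y\<bar> * (g x)\<^sup>2))"
      by (auto simp: abs_mult algebra_simps intro!: AE_I2)
  qed measurable
  have "L2_inner (fun_convolution k f) g = (\<integral>x. (\<integral>y. k y * f (x - y) * g x \<partial>lborel) \<partial>lborel)"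
    by (simp add: L2_inner_def fun_convolution_def)
  also have "\<dots> = (\<integral>y. (\<integral>x. k y * f (x - y) * g x \<partial>lborel) \<partial>lborel)"
    using lborel_pair.Fubini_integral[OF int] by simp
  also have "\<dots> = (\<integral>y. k y * correlation f g y \<partial>lborel)"
    by (simp add: correlation_def L2_inner_def mult.assoc)
  finally show ?thesis .
qed

section \<open>The Fourier transform of integrable functions\<close>

text \<open>The definition of the spectral function is that of the Fourier transform, here applied to kernels as well
  as to covariance functions.\<close>

abbreviation fourier :: "(real \<Rightarrow> real) \<Rightarrow> real \<Rightarrow> complex" where
  "fourier \<equiv> spectral_function"

lemma fourier_scaleR: "fourier k \<xi> = (\<integral>x. k x *\<^sub>R iexp (\<xi> * x) \<partial>lborel)"
  by (simp add: spectral_function_def scaleR_conv_of_real mult.commute)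

lemma integrable_scaleR_bounded:
  fixes c :: "real \<Rightarrow> 'a :: {banach, second_countable_topology}"
  assumes k: "integrable lborel k" and c: "c \<in> borel_measurable borel" "\<And>x. norm (c x) \<le> B"
  shows "integrable lborel (\<lambda>x. k x *\<^sub>R c x)"
proof (rule Bochner_Integration.integrable_bound)
  note [measurable] = c(1) integrable_borel[OF k]
  show "integrable lborel (\<lambda>x. B * k x)" using k by simp
  have "\<bar>k x\<bar> * norm (c x) \<le> \<bar>k x\<bar> * \<bar>B\<bar>" for x
    using c(2)[of x] by (intro mult_left_mono) auto
  then show "AE x in lborel. norm (k x *\<^sub>R c x) \<le> norm (B * k x)"
    by (simp add: abs_mult mult.commute)
  show "(\<lambda>x. k x *\<^sub>R c x) \<in> borel_measurable lborel" by measurable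
qed

lemma iexp_measurable: "(\<lambda>x. iexp (\<xi> * x)) \<in> borel_measurable borel"
  by measurable

lemma fourier_integrable:
  assumes "integrable lborel k"
  shows "integrable lborel (\<lambda>x. k x *\<^sub>R iexp (\<xi> * x))"
  by (rule integrable_scaleR_bounded[OF assms iexp_measurable, where B = 1]) simp

lemma fourier_diff:
  assumes "integrable lborel k" "integrable lborel l"
  shows "fourier (\<lambda>x. k x - l x) \<xi> = fourier k \<xi> - fourier l \<xi>"
  using fourier_integrable[OF assms(1)] fourier_integrable[OF assms(2)]
  by (simp add: fourier_scaleR scaleR_diff_left)

lemma fourier_cmult: "fourier (\<lambda>x. c * k x) \<xi> = c * fourier k \<xi>"
  by (simp add: fourier_scaleR scaleR_conv_of_real mult.assoc)

lemma fourier_cong_AE: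
  assumes "k \<in> borel_measurable borel" "l \<in> borel_measurable borel" "AE x in lborel. k x = l x"
  shows "fourier k \<xi> = fourier l \<xi>"
  unfolding fourier_scaleR
  using assms(3) by (intro integral_cong_AE) (use assms(1,2) in \<open>auto elim: eventually_mono\<close>)

lemma fourier_fun_convolution:
  assumes k: "integrable lborel k" and l: "integrable lborel l"
  shows "fourier (fun_convolution k l) \<xi> = fourier k \<xi> * fourier l \<xi>"
proof -
  have "fourier (fun_convolution k l) \<xi> = (\<integral>y. k y *\<^sub>R (\<integral>z. l z *\<^sub>R iexp (\<xi> * (y + z)) \<partial>lborel) \<partial>lborel)"
    unfolding fourier_scaleR
    by (rule integral_fun_convolution[OF k l iexp_measurable, where B = 1]) simp
  also have "\<dots> = (\<integral>y. (k y *\<^sub>R iexp (\<xi> * y)) * fourier l \<xi> \<partial>lborel)"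
  proof (rule Bochner_Integration.integral_cong)
    fix y :: real
    have "l z *\<^sub>R iexp (\<xi> * (y + z)) = iexp (\<xi> * y) * (l z *\<^sub>R iexp (\<xi> * z))" for z
      by (simp add: distrib_left exp_add)
    then have "(\<integral>z. l z *\<^sub>R iexp (\<xi> * (y + z)) \<partial>lborel) = (\<integral>z. iexp (\<xi> * y) * (l z *\<^sub>R iexp (\<xi> * z)) \<partial>lborel)"
      by (simp only:)
    also have "\<dots> = iexp (\<xi> * y) * fourier l \<xi>"
      unfolding fourier_scaleR by (rule integral_mult_right_zero)
    finally show "k y *\<^sub>R (\<integral>z. l z *\<^sub>R iexp (\<xi> * (y + z)) \<partial>lborel) = (k y *\<^sub>R iexp (\<xi> * y)) * fourier l \<xi>"
      by simp
  qed simp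
  also have "\<dots> = fourier k \<xi> * fourier l \<xi>"
    unfolding fourier_scaleR[of k] by (rule integral_mult_left_zero)
  finally show ?thesis .
qed

text \<open>The positive and negative parts of \<open>k - l\<close> have the same mass, the value of the transform at
  \<open>0\<close>. Unless both vanish, dividing by this mass turns them into probability densities with equal
  characteristic functions, which agree by Levy's uniqueness theorem.\<close>

lemma fourier_injective:
  assumes k: "integrable lborel k" and l: "integrable lborel l"
    and eq: "\<And>\<xi>. fourier k \<xi> = fourier l \<xi>"
  shows "AE x in lborel. k x = l x"
proof -
  define h p m where "h = (\<lambda>x. k x - l x)" and "p = (\<lambda>x. max 0 (h x))" and "m = (\<lambda>x. max 0 (- h x))"
  have h: "integrable lborel h" using k l by (simp add: h_def)
  have p: "integrable lborel p" and m: "integrable lborel m"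
    using h by (simp_all add: p_def m_def)
  have h_pm: "h = (\<lambda>x. p x - m x)" by (auto simp: p_def m_def)
  have pm: "fourier p \<xi> = fourier m \<xi>" for \<xi>
  proof -
    have "fourier h \<xi> = 0" unfolding h_def using fourier_diff[OF k l] eq by simp
    then show ?thesis using fourier_diff[OF p m] by (simp add: h_pm)
  qed
  have p0: "0 \<le> p x" and m0: "0 \<le> m x" for x by (auto simp: p_def m_def)
  define c where "c = (\<integral>x. p x \<partial>lborel)"
  have "complex_of_real (\<integral>x. p x \<partial>lborel) = complex_of_real (\<integral>x. m x \<partial>lborel)"
    using pm[of 0] by (simp add: spectral_function_def)
  then have cm: "(\<integral>x. m x \<partial>lborel) = c" by (simp only: of_real_eq_iff c_def)
  have "AE x in lborel. p x = m x"
  proof (cases "c = 0")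
    case True
    have "AE x in lborel. p x = 0"
      using integral_nonneg_eq_0_iff_AE[OF p] p0 True by (simp add: c_def)
    moreover have "AE x in lborel. m x = 0"
      using integral_nonneg_eq_0_iff_AE[OF m] m0 True cm by simp
    ultimately show ?thesis by eventually_elim simp
  next
    case False
    have c: "0 < c" using False p0 by (simp add: c_def integral_nonneg_AE less_le)
    have dist: "real_distribution (density lborel (\<lambda>x. ennreal (q x / c)))"
      if q: "integrable lborel q" "\<And>x. 0 \<le> q x" "(\<integral>x. q x \<partial>lborel) = c" for q
    proof -
      have "prob_space (density lborel (\<lambda>x. ennreal (q x / c)))"
      proof (rule prob_spaceI)
        have "(\<integral>\<^sup>+x. ennreal (q x / c) \<partial>lborel) = ennreal (\<integral>x. q x / c \<partial>lborel)"
          using q c by (intro nn_integral_eq_integral) auto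
        also have "\<dots> = 1" using q(3) c by simp
        finally show "emeasure (density lborel (\<lambda>x. ennreal (q x / c)))
            (space (density lborel (\<lambda>x. ennreal (q x / c)))) = 1"
          using q(1) integrable_borel[OF q(1)] by (subst emeasure_density) auto
      qed
      then show ?thesis by (simp add: real_distribution_def real_distribution_axioms_def)
    qed
    have char: "char (density lborel (\<lambda>x. ennreal (q x / c))) \<xi> = fourier q \<xi> / c"
      if q: "integrable lborel q" "\<And>x. 0 \<le> q x" for q \<xi>
    proof -
      have "char (density lborel (\<lambda>x. ennreal (q x / c))) \<xi> = (\<integral>x. (q x / c) *\<^sub>R iexp (\<xi> * x) \<partial>lborel)"
        unfolding char_def using c q integrable_borel[OF q(1)] by (intro integral_density) auto
      also have "\<dots> = (\<integral>x. (q x *\<^sub>R iexp (\<xi> * x)) / c \<partial>lborel)"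
        by (simp add: scaleR_conv_of_real)
      also have "\<dots> = fourier q \<xi> / c" by (simp add: fourier_scaleR)
      finally show ?thesis .
    qed
    have "density lborel (\<lambda>x. ennreal (p x / c)) = density lborel (\<lambda>x. ennreal (m x / c))"
      using p p0 m m0 cm c_def dist char pm by (intro Levy_uniqueness) (auto simp: fun_eq_iff)
    then have "AE x in lborel. ennreal (p x / c) = ennreal (m x / c)"
      using integrable_borel[OF p] integrable_borel[OF m]
      by (intro sigma_finite_measure.density_unique[OF sigma_finite_lborel]) auto
    then show ?thesis by eventually_elim (use c p0 m0 in simp)
  qed
  then show ?thesis
    by eventually_elim (auto simp: p_def m_def h_def max_def split: if_splits)
qed

section \<open>The algebra of convolution operators\<close>

lemma fun_convolution_cmult_left:
  "fun_convolution (\<lambda>x. c * k x) f = (\<lambda>x. c * fun_convolution k f x)"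
  by (simp add: fun_convolution_def fun_eq_iff mult.assoc)

lemma fun_convolution_cong_AE:
  assumes [measurable]: "k \<in> borel_measurable borel" "k' \<in> borel_measurable borel" "f \<in> borel_measurable borel"
    and "AE x in lborel. k x = k' x"
  shows "fun_convolution k f = fun_convolution k' f"
  unfolding fun_convolution_def fun_eq_iff
proof
  fix s
  show "(\<integral>x. k x * f (s - x) \<partial>lborel) = (\<integral>x. k' x * f (s - x) \<partial>lborel)"
    using assms(4) by (intro integral_cong_AE) (measurable, auto elim: eventually_mono)
qed

lemma fun_convolution_linear:
  assumes k: "integrable lborel k" and f: "f \<in> L2_space" and g: "g \<in> L2_space"
  shows "AE x in lborel. fun_convolution k (\<lambda>y. a * f y + b * g y) x =
    a * fun_convolution k f x + b * fun_convolution k g x"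
  using fun_convolution_AE_integrable[OF k f] fun_convolution_AE_integrable[OF k g]
proof eventually_elim
  case (elim x)
  have "fun_convolution k (\<lambda>y. a * f y + b * g y) x =
      (\<integral>y. a * (k y * f (x - y)) + b * (k y * g (x - y)) \<partial>lborel)"
    by (simp add: fun_convolution_def algebra_simps)
  also have "\<dots> = a * fun_convolution k f x + b * fun_convolution k g x"
    using elim by (simp add: fun_convolution_def)
  finally show ?case .
qed

lemma bounded_L2_operator_fun_convolution:
  assumes "integrable lborel k"
  shows "bounded_L2_operator (fun_convolution k)"
  unfolding bounded_L2_operator_def
  using fun_convolution_L2[OF assms] fun_convolution_linear[OF assms] by blast

text \<open>Reflecting a kernel produces the adjoint operator, so an even kernel acts as a symmetric operator.\<close>

lemma L2_inner_fun_convolution_symmetric: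
  assumes k: "integrable lborel k" "\<And>x. k (- x) = k x" and f: "f \<in> L2_space" and g: "g \<in> L2_space"
  shows "L2_inner (fun_convolution k f) g = L2_inner f (fun_convolution k g)"
proof -
  have "L2_inner (fun_convolution k f) g = (\<integral>y. k (0 - y) * correlation g f (0 - y) \<partial>lborel)"
    by (simp add: L2_inner_fun_convolution[OF k(1) f g] k(2) correlation_commute[of f g])
  also have "\<dots> = (\<integral>y. k y * correlation g f y \<partial>lborel)"
    by (rule lborel_integral_reflect)
  also have "\<dots> = L2_inner f (fun_convolution k g)"
    by (simp add: L2_inner_fun_convolution[OF k(1) g f] L2_inner_commute[of f])
  finally show ?thesis .
qed

lemma correlation_fun_convolution:
  assumes k: "integrable lborel k" and f: "f \<in> L2_space" and g: "g \<in> L2_space"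
  shows "correlation (fun_convolution k f) g y = (\<integral>z. k z * correlation f g (y + z) \<partial>lborel)"
proof -
  have g': "(\<lambda>x. g (x + y)) \<in> L2_space" using L2_shift[OF g, of "-y"] by simp
  have "correlation (fun_convolution k f) g y = L2_inner (fun_convolution k f) (\<lambda>x. g (x + y))"
    unfolding correlation_def by (rule L2_inner_shift_move)
  also have "\<dots> = (\<integral>z. k z * correlation f g (y + z) \<partial>lborel)"
    using L2_inner_fun_convolution[OF k f g'] correlation_shift_right[of f g "-y"]
    by (simp add: add.commute)
  finally show ?thesis .
qed

text \<open>Tested against \<open>h\<close>, both sides are the double integral of \<open>k y * l z\<close> times the
  correlation of \<open>f\<close> and \<open>h\<close> at \<open>y + z\<close>.\<close>

lemma fun_convolution_assoc:
  assumes k: "integrable lborel k" and l: "integrable lborel l" and f: "f \<in> L2_space"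
  shows "AE x in lborel. fun_convolution (fun_convolution k l) f x = fun_convolution k (fun_convolution l f) x"
proof (rule L2_AE_eqI)
  have kl: "integrable lborel (fun_convolution k l)" using k l by (rule fun_convolution_integrable)
  show "fun_convolution (fun_convolution k l) f \<in> L2_space" using kl f by (rule fun_convolution_L2)
  have lf: "fun_convolution l f \<in> L2_space" using l f by (rule fun_convolution_L2)
  then show "fun_convolution k (fun_convolution l f) \<in> L2_space" by (rule fun_convolution_L2[OF k])
  fix h assume h: "h \<in> L2_space"
  have "L2_inner (fun_convolution (fun_convolution k l) f) h
      = (\<integral>z. fun_convolution k l z *\<^sub>R correlation f h z \<partial>lborel)"
    by (simp add: L2_inner_fun_convolution[OF kl f h])
  also have "\<dots> = (\<integral>y. k y *\<^sub>R (\<integral>z. l z *\<^sub>R correlation f h (y + z) \<partial>lborel) \<partial>lborel)"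
    using correlation_bound[OF f h] correlation_measurable[OF L2_space_borel L2_space_borel, OF f h]
    by (intro integral_fun_convolution[OF k l]) auto
  also have "\<dots> = L2_inner (fun_convolution k (fun_convolution l f)) h"
    by (simp add: L2_inner_fun_convolution[OF k lf h] correlation_fun_convolution[OF l f h])
  finally show "L2_inner (fun_convolution (fun_convolution k l) f) h =
    L2_inner (fun_convolution k (fun_convolution l f)) h" .
qed

section \<open>Approximate identities\<close>

lemma dominated_convergence_at_within:
  fixes s :: "real \<Rightarrow> 'b \<Rightarrow> real"
  assumes "\<And>t. s t \<in> borel_measurable M" "f \<in> borel_measurable M" "integrable M w"
    and lim: "AE x in M. ((\<lambda>t. s t x) \<longlongrightarrow> f x) (at a within S)"
    and bound: "\<And>t. t \<in> S \<Longrightarrow> AE x in M. \<bar>s t x\<bar> \<le> w x"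
  shows "((\<lambda>t. \<integral>x. s t x \<partial>M) \<longlongrightarrow> (\<integral>x. f x \<partial>M)) (at a within S)"
  unfolding tendsto_at_iff_sequentially
proof safe
  fix X :: "nat \<Rightarrow> real" assume X: "\<forall>i. X i \<in> S - {a}" "X \<longlonglongrightarrow> a"
  show "((\<lambda>t. \<integral>x. s t x \<partial>M) \<circ> X) \<longlonglongrightarrow> (\<integral>x. f x \<partial>M)"
    unfolding comp_def
  proof (rule integral_dominated_convergence[where w = w])
    show "AE x in M. (\<lambda>i. s (X i) x) \<longlonglongrightarrow> f x"
      using lim by eventually_elim (use X in \<open>auto simp: tendsto_at_iff_sequentially comp_def\<close>)
    show "AE x in M. norm (s (X i) x) \<le> w x" for i
      using bound[of "X i"] X by auto
  qed (use assms in auto)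
qed

lemma tendsto_at_right_of_isCont:
  fixes c :: "real \<Rightarrow> real"
  assumes "isCont c 0"
  shows "((\<lambda>\<epsilon>. c (\<epsilon> * x)) \<longlongrightarrow> c 0) (at_right 0)"
proof -
  have "((\<lambda>\<epsilon>::real. \<epsilon> * x) \<longlongrightarrow> 0 * x) (at_right 0)" by (intro tendsto_intros)
  then have "((\<lambda>\<epsilon>::real. \<epsilon> * x) \<longlongrightarrow> 0) (at_right 0)" by simp
  with assms show ?thesis by (rule isCont_tendsto_compose)
qed

lemma L2_dominated_tendsto:
  fixes F :: "nat \<Rightarrow> real \<Rightarrow> real"
  assumes "\<And>j. F j \<in> borel_measurable borel" "f \<in> borel_measurable borel" "w \<in> L2_space"
    and "AE x in lborel. (\<lambda>j. F j x) \<longlonglongrightarrow> f x" "\<And>j. AE x in lborel. \<bar>f x - F j x\<bar> \<le> \<bar>w x\<bar>"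
  shows "(\<lambda>j. L2_norm (\<lambda>x. f x - F j x)) \<longlonglongrightarrow> 0"
proof -
  note [measurable] = assms(1,2)
  have "(\<lambda>j. \<integral>x. (f x - F j x)\<^sup>2 \<partial>lborel) \<longlonglongrightarrow> (\<integral>x. 0 \<partial>(lborel :: real measure))"
  proof (rule integral_dominated_convergence[where w = "\<lambda>x. (w x)\<^sup>2"])
    show "AE x in lborel. (\<lambda>j. (f x - F j x)\<^sup>2) \<longlonglongrightarrow> 0"
      using assms(4)
    proof eventually_elim
      case (elim x)
      then have "(\<lambda>j. (f x - F j x)\<^sup>2) \<longlonglongrightarrow> (f x - f x)\<^sup>2" by (intro tendsto_intros)
      then show ?case by simp
    qed
    show "AE x in lborel. norm ((f x - F j x)\<^sup>2) \<le> (w x)\<^sup>2" for j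
      using assms(5)[of j] by eventually_elim (simp add: abs_le_square_iff)
  qed (use assms(3) in \<open>auto simp: L2_space_def\<close>)
  then have "(\<lambda>j. sqrt (\<integral>x. (f x - F j x)\<^sup>2 \<partial>lborel)) \<longlonglongrightarrow> sqrt 0"
    by (intro tendsto_real_sqrt) simp
  then show ?thesis by (simp add: L2_norm_def L2_inner_def power2_eq_square)
qed

lemma L2_bounded_support:
  assumes [measurable]: "f \<in> borel_measurable borel" and "\<And>x. \<bar>f x\<bar> \<le> B" "\<And>x. R < \<bar>x\<bar> \<Longrightarrow> f x = 0"
  shows "f \<in> L2_space"
proof -
  have "integrable lborel (\<lambda>x. (f x)\<^sup>2)"
  proof (rule Bochner_Integration.integrable_bound)
    show "integrable lborel (\<lambda>x. indicator {-R..R} x *\<^sub>R B\<^sup>2)"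
      by (intro integrable_scaleR_left integrable_real_indicator) (auto simp: emeasure_lborel_Icc_eq)
    show "AE x in lborel. norm ((f x)\<^sup>2) \<le> norm (indicator {-R..R} x *\<^sub>R B\<^sup>2)"
    proof (rule AE_I2)
      fix x
      have "(f x)\<^sup>2 \<le> B\<^sup>2" using power_mono[OF assms(2)[of x], of 2] by simp
      then show "norm ((f x)\<^sup>2) \<le> norm (indicator {-R..R} x *\<^sub>R B\<^sup>2)"
        using assms(3)[of x] by (cases "\<bar>x\<bar> \<le> R") (auto split: split_indicator)
    qed
  qed measurable
  then show ?thesis by (simp add: L2_space_def)
qed

text \<open>Cutting \<open>f\<close> off in space and in height costs little by dominated convergence. A measurable function
  is an almost everywhere limit of continuous ones; after the same cut-off these converge in $L^2$, because now
  they are bounded with a common compact support.\<close>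

lemma L2_continuous_approximation:
  assumes f: "f \<in> L2_space" and e: "0 < e"
  obtains g R B where "continuous_on UNIV g" "\<And>x. R < \<bar>x\<bar> \<Longrightarrow> g x = 0" "\<And>x. \<bar>g x\<bar> \<le> B"
    "g \<in> L2_space" "L2_norm (\<lambda>x. f x - g x) < e"
proof -
  note [measurable] = L2_space_borel[OF f]
  \<comment> \<open>A continuous cut-off in space times a truncation in height; both keep continuous functions continuous.\<close>
  define clamp :: "nat \<Rightarrow> real \<Rightarrow> real \<Rightarrow> real" where
    "clamp N x v = max 0 (min 1 (real N + 1 - \<bar>x\<bar>)) * max (- real N) (min (real N) v)" for N x v
  have clamp_bound: "\<bar>clamp N x v\<bar> \<le> real N" for N x v
  proof -
    have "\<bar>clamp N x v\<bar> \<le> 1 * real N"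
      unfolding clamp_def abs_mult by (rule mult_mono) auto
    then show ?thesis by simp
  qed
  have clamp_supp: "clamp N x v = 0" if "real N + 1 < \<bar>x\<bar>" for N x v
    using that by (simp add: clamp_def)
  have clamp_le: "\<bar>v - clamp N x v\<bar> \<le> \<bar>v\<bar>" for N x v
  proof -
    define a b where "a = max 0 (min 1 (real N + 1 - \<bar>x\<bar>))" and "b = max (- real N) (min (real N) v)"
    have a: "0 \<le> a" "a \<le> 1" unfolding a_def by auto
    have "0 \<le> v \<Longrightarrow> 0 \<le> b \<and> b \<le> v" "v \<le> 0 \<Longrightarrow> b \<le> 0 \<and> v \<le> b" unfolding b_def by auto
    moreover have "0 \<le> a * b \<and> a * b \<le> b" if "0 \<le> b"
      using a that mult_left_le_one_le[of b a] by (simp only: mult_nonneg_nonneg)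
    moreover have "a * b \<le> 0 \<and> b \<le> a * b" if "b \<le> 0"
      using a that mult_left_le_one_le[of "-b" a] by (simp add: mult_nonneg_nonpos)
    ultimately have "\<bar>v - a * b\<bar> \<le> \<bar>v\<bar>" by (cases "0 \<le> v") auto
    then show ?thesis unfolding clamp_def a_def b_def .
  qed
  have clamp_meas[measurable]: "(\<lambda>x. clamp N x (q x)) \<in> borel_measurable borel"
    if [measurable]: "q \<in> borel_measurable borel" for N q
    unfolding clamp_def by measurable
  have "(\<lambda>N. L2_norm (\<lambda>x. f x - clamp N x (f x))) \<longlonglongrightarrow> 0"
  proof (rule L2_dominated_tendsto[OF _ _ f])
    show "AE x in lborel. (\<lambda>N. clamp N x (f x)) \<longlonglongrightarrow> f x"
    proof (rule AE_I2)
      fix x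
      obtain N0 :: nat where N0: "\<bar>x\<bar> + \<bar>f x\<bar> \<le> real N0" using real_arch_simple by blast
      have "clamp N x (f x) = f x" if "N0 \<le> N" for N
      proof -
        have "real N0 \<le> real N" using that by simp
        then have "max 0 (min 1 (real N + 1 - \<bar>x\<bar>)) = 1" "max (- real N) (min (real N) (f x)) = f x"
          using N0 by linarith+
        then show ?thesis by (simp add: clamp_def)
      qed
      then show "(\<lambda>N. clamp N x (f x)) \<longlonglongrightarrow> f x"
        by (intro tendsto_eventually eventually_sequentiallyI[of N0])
    qed
  qed (use clamp_le in auto)
  from LIMSEQ_D[OF this, of "e / 2"] e
  obtain N where N: "L2_norm (\<lambda>x. f x - clamp N x (f x)) < e / 2"
    by (auto simp: L2_norm_nonneg)
  have "f \<in> borel_measurable lebesgue" by (intro measurable_completion) simp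
  then have "f measurable_on UNIV"
    using measurable_on_iff_borel_measurable[of UNIV f] by (simp add: lebesgue_on_UNIV_eq)
  then obtain Z h where Z: "negligible Z" and h: "\<And>n::nat. continuous_on UNIV (h n)"
    and lim: "\<And>x. x \<notin> Z \<Longrightarrow> (\<lambda>n. h n x) \<longlonglongrightarrow> f x"
    unfolding measurable_on_def by auto
  have "AE x in completion lborel. x \<notin> Z"
    using Z unfolding negligible_iff_null_sets by (rule AE_not_in)
  then have Z': "AE x in lborel. x \<notin> Z" by (simp add: AE_completion_iff)
  define g where "g j x = clamp N x (h j x)" for j x
  have g_cont: "continuous_on UNIV (g j)" for j
    unfolding g_def clamp_def by (intro continuous_intros h)
  have [measurable]: "g j \<in> borel_measurable borel" for j
    using g_cont by (rule borel_measurable_continuous_onI)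
  have "(\<lambda>j. L2_norm (\<lambda>x. clamp N x (f x) - g j x)) \<longlonglongrightarrow> 0"
  proof (rule L2_dominated_tendsto)
    show "(\<lambda>x. indicator {- (real N + 1)..real N + 1} x * (2 * real N)) \<in> L2_space"
      by (rule L2_bounded_support[where B = "2 * real N" and R = "real N + 1"])
         (auto split: split_indicator)
    show "AE x in lborel. (\<lambda>j. g j x) \<longlonglongrightarrow> clamp N x (f x)"
      using Z' unfolding g_def clamp_def by eventually_elim (intro tendsto_intros lim)
    show "AE x in lborel. \<bar>clamp N x (f x) - g j x\<bar> \<le> \<bar>indicator {- (real N + 1)..real N + 1} x * (2 * real N)\<bar>" for j
    proof (rule AE_I2)
      fix x
      show "\<bar>clamp N x (f x) - g j x\<bar> \<le> \<bar>indicator {- (real N + 1)..real N + 1} x * (2 * real N)\<bar>"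
        using clamp_bound[of N x "f x"] clamp_bound[of N x "h j x"]
          clamp_supp[of N x "f x"] clamp_supp[of N x "h j x"]
        by (cases "real N + 1 < \<bar>x\<bar>") (auto simp: g_def split: split_indicator)
    qed
  qed measurable
  from LIMSEQ_D[OF this, of "e / 2"] e
  obtain j where j: "L2_norm (\<lambda>x. clamp N x (f x) - g j x) < e / 2"
    by (auto simp: L2_norm_nonneg)
  have g2: "g j \<in> L2_space"
    using clamp_bound clamp_supp
    by (intro L2_bounded_support[where B = "real N" and R = "real N + 1"]) (auto simp: g_def)
  have c2: "(\<lambda>x. clamp N x (f x)) \<in> L2_space"
    using clamp_bound clamp_supp
    by (intro L2_bounded_support[where B = "real N" and R = "real N + 1"]) auto
  have "L2_norm (\<lambda>x. f x - g j x) < e"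
    using L2_norm_triangle_diff[OF f c2 g2] N j by simp
  then show thesis
    using g_cont clamp_bound clamp_supp g2 that[of "g j" "real N + 1" "real N"] by (auto simp: g_def)
qed

text \<open>If one factor is continuous with compact support, dominated convergence applies; replacing that factor
  changes the correlation uniformly little, by the Cauchy-Schwarz inequality.\<close>

lemma correlation_continuous_at_0:
  assumes f: "f \<in> L2_space"
  shows "isCont (correlation f f) 0"
  unfolding isCont_def
proof (rule LIM_I)
  fix r :: real assume r: "0 < r"
  \<comment> \<open>The summand \<open>1\<close> guards against division by zero if \<open>f\<close> vanishes.\<close>
  define e where "e = r / (4 * (L2_norm f + 1))"
  have e: "0 < e" using r L2_norm_nonneg[of f] by (simp add: e_def)
  obtain g R B where g: "continuous_on UNIV g" "\<And>x. R < \<bar>x\<bar> \<Longrightarrow> g x = 0" "\<And>x. \<bar>g x\<bar> \<le> B"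
    "g \<in> L2_space" "L2_norm (\<lambda>x. f x - g x) < e"
    using L2_continuous_approximation[OF f e] by blast
  note [measurable] = L2_space_borel[OF f] L2_space_borel[OF g(4)]
  have near: "\<bar>correlation f f y - correlation f g y\<bar> \<le> r / 4" for y
  proof -
    have fg: "(\<lambda>x. f x - g x) \<in> L2_space" using f g(4) by (rule L2_diff)
    have "correlation f f y - correlation f g y = correlation f (\<lambda>x. f x - g x) y"
      using L2_inner_diff_left[OF f g(4) L2_shift[OF f], of y] unfolding correlation_def
      by (simp add: L2_inner_commute)
    then have "\<bar>correlation f f y - correlation f g y\<bar> \<le> L2_norm f * L2_norm (\<lambda>x. f x - g x)"
      using correlation_bound[OF f fg] by simp
    also have "\<dots> \<le> (L2_norm f + 1) * e"
      using g(5) L2_norm_nonneg by (intro mult_mono) auto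
    also have "\<dots> = r / 4"
      using L2_norm_nonneg[of f] unfolding e_def by (simp add: divide_simps)
    finally show ?thesis .
  qed
  have "((\<lambda>y. \<integral>x. f x * g (x + y) \<partial>lborel) \<longlongrightarrow> (\<integral>x. f x * g (x + 0) \<partial>lborel)) (at 0 within {-1<..<1})"
  proof (rule dominated_convergence_at_within)
    let ?w = "\<lambda>x. \<bar>f x\<bar> * (indicator {-(R + 1)..R + 1} x * B)"
    have "(\<lambda>x. indicator {-(R + 1)..R + 1} x * B) \<in> L2_space"
      by (rule L2_bounded_support[where B = "\<bar>B\<bar>" and R = "R + 1"]) (auto split: split_indicator)
    then show "integrable lborel ?w" by (intro L2_mult_integrable L2_abs f)
    show "AE x in lborel. \<bar>f x * g (x + y)\<bar> \<le> ?w x" if "y \<in> {-1<..<1}" for y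
    proof (rule AE_I2)
      fix x
      have "\<bar>g (x + y)\<bar> \<le> indicator {-(R + 1)..R + 1} x * B"
        using g(2)[of "x + y"] g(3)[of "x + y"] that by (auto split: split_indicator)
      then show "\<bar>f x * g (x + y)\<bar> \<le> ?w x" by (simp add: abs_mult mult_left_mono)
    qed
    have "isCont g x" for x using g(1) by (simp add: continuous_on_eq_continuous_at)
    then have "((\<lambda>y. g (x + y)) \<longlongrightarrow> g (x + 0)) (at 0 within {-1<..<1})" for x
      by (intro isCont_tendsto_compose[of _ g] tendsto_intros) simp
    then show "AE x in lborel. ((\<lambda>y. f x * g (x + y)) \<longlongrightarrow> f x * g (x + 0)) (at 0 within {-1<..<1})"
      by (intro AE_I2 tendsto_intros)
  qed measurable
  moreover have "correlation f g y = (\<integral>x. f x * g (x + y) \<partial>lborel)" for y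
    unfolding correlation_def L2_inner_shift_move by (simp add: L2_inner_def)
  ultimately have "((\<lambda>y. correlation f g y) \<longlongrightarrow> correlation f g 0) (at 0)"
    by (simp add: at_within_open[of 0 "{-1<..<1::real}"]  )
  from LIM_D[OF this, of "r / 4"] r
  obtain s where s: "0 < s" "\<And>y. y \<noteq> 0 \<Longrightarrow> \<bar>y\<bar> < s \<Longrightarrow> \<bar>correlation f g y - correlation f g 0\<bar> < r / 4"
    by auto
  have "\<bar>correlation f f y - correlation f f 0\<bar> < r" if "y \<noteq> 0" "\<bar>y\<bar> < s" for y
    using near[of y] near[of 0] s(2)[OF that] r by linarith
  with s(1) show "\<exists>s>0. \<forall>y. y \<noteq> 0 \<and> norm (y - 0) < s \<longrightarrow> norm (correlation f f y - correlation f f 0) < r"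
    by auto
qed

definition dilate :: "real \<Rightarrow> (real \<Rightarrow> real) \<Rightarrow> real \<Rightarrow> real" where
  "dilate \<epsilon> k x = k (x / \<epsilon>) / \<epsilon>"

lemma dilate_integrable:
  assumes "integrable lborel k" "0 < \<epsilon>"
  shows "integrable lborel (dilate \<epsilon> k)"
  using lborel_integrable_real_affine[OF assms(1), of "1/\<epsilon>" 0] assms(2)
  by (simp add: dilate_def[abs_def])

lemma integral_dilate:
  fixes c :: "real \<Rightarrow> 'a :: {banach, second_countable_topology}"
  assumes "0 < \<epsilon>"
  shows "(\<integral>x. dilate \<epsilon> k x *\<^sub>R c x \<partial>lborel) = (\<integral>x. k x *\<^sub>R c (\<epsilon> * x) \<partial>lborel)"
  using lborel_integral_real_affine[of \<epsilon> "\<lambda>x. dilate \<epsilon> k x *\<^sub>R c x" 0] assms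
  by (simp add: dilate_def flip: integral_scaleR_right)

lemma L1_norm_dilate:
  assumes "0 < \<epsilon>"
  shows "L1_norm (dilate \<epsilon> k) = L1_norm k"
  using integral_dilate[OF assms, of "\<lambda>x. \<bar>k x\<bar>" "\<lambda>_. 1::real"] assms
  by (simp add: L1_norm_def dilate_def)

text \<open>Expanding the square of the norm leaves only integrals of \<open>k\<close> against the autocorrelation
  \<open>c\<close> of \<open>f\<close> at arguments proportional to \<open>\<epsilon>\<close>. All of them tend to
  \<open>c 0\<close>, so the limit is \<open>c 0 - 2 * c 0 + c 0\<close>. Continuity of \<open>c\<close> at the origin
  is the form in which continuity of translations in $L^2$ enters.\<close>

lemma approximate_identity:
  assumes k: "integrable lborel k" "(\<integral>x. k x \<partial>lborel) = 1" and f: "f \<in> L2_space"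
  shows "((\<lambda>\<epsilon>. L2_norm (\<lambda>x. fun_convolution (dilate \<epsilon> k) f x - f x)) \<longlongrightarrow> 0) (at_right 0)"
proof -
  define c where "c = correlation f f"
  note [measurable] = integrable_borel[OF k(1)] L2_space_borel[OF f]
  have [measurable]: "c \<in> borel_measurable borel"
    unfolding c_def by (intro correlation_measurable) auto
  define B where "B = L2_norm f * L2_norm f"
  have cB: "\<bar>c y\<bar> \<le> B" for y unfolding c_def B_def using f f by (rule correlation_bound)
  have B: "0 \<le> B" by (simp add: B_def)
  have c0: "isCont c 0" unfolding c_def using f by (rule correlation_continuous_at_0)
  have inner_lim: "((\<lambda>\<epsilon>. \<integral>x. k x * c (\<epsilon> * (x - y)) \<partial>lborel) \<longlongrightarrow> c 0) (at_right 0)" for y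
  proof -
    have "((\<lambda>\<epsilon>. \<integral>x. k x * c (\<epsilon> * (x - y)) \<partial>lborel) \<longlongrightarrow> (\<integral>x. k x * c 0 \<partial>lborel)) (at_right 0)"
    proof (rule dominated_convergence_at_within)
      show "integrable lborel (\<lambda>x. \<bar>k x\<bar> * B)" using k by simp
      show "AE x in lborel. ((\<lambda>\<epsilon>. k x * c (\<epsilon> * (x - y))) \<longlongrightarrow> k x * c 0) (at_right 0)"
        using tendsto_at_right_of_isCont[OF c0] by (intro AE_I2 tendsto_intros)
      show "AE x in lborel. \<bar>k x * c (\<epsilon> * (x - y))\<bar> \<le> \<bar>k x\<bar> * B" for \<epsilon>
        using cB by (intro AE_I2) (simp add: abs_mult mult_left_mono)
    qed measurable
    then show ?thesis using k(2) by simp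
  qed
  have inner_bound: "\<bar>\<integral>x. k x * c (\<epsilon> * (x - y)) \<partial>lborel\<bar> \<le> L1_norm k * B" for \<epsilon> y
  proof -
    have "\<bar>\<integral>x. k x * c (\<epsilon> * (x - y)) \<partial>lborel\<bar> \<le> (\<integral>x. \<bar>k x * c (\<epsilon> * (x - y))\<bar> \<partial>lborel)"
      by (rule integral_abs_bound)
    also have "\<dots> \<le> (\<integral>x. \<bar>k x\<bar> * B \<partial>lborel)"
    proof (rule integral_mono)
      have "integrable lborel (\<lambda>x. k x *\<^sub>R c (\<epsilon> * (x - y)))"
        by (rule integrable_scaleR_bounded[OF k(1), where B = B]) (use cB in auto)
      then show "integrable lborel (\<lambda>x. \<bar>k x * c (\<epsilon> * (x - y))\<bar>)" by simp
      show "\<bar>k x * c (\<epsilon> * (x - y))\<bar> \<le> \<bar>k x\<bar> * B" for x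
        using cB by (simp add: abs_mult mult_left_mono)
    qed (use k in simp)
    finally show ?thesis by (simp add: L1_norm_def)
  qed
  have outer_lim: "((\<lambda>\<epsilon>. \<integral>y. k y * (\<integral>x. k x * c (\<epsilon> * (x - y)) \<partial>lborel) \<partial>lborel) \<longlongrightarrow> c 0) (at_right 0)"
  proof -
    have "((\<lambda>\<epsilon>. \<integral>y. k y * (\<integral>x. k x * c (\<epsilon> * (x - y)) \<partial>lborel) \<partial>lborel) \<longlongrightarrow> (\<integral>y. k y * c 0 \<partial>lborel)) (at_right 0)"
    proof (rule dominated_convergence_at_within)
      show "integrable lborel (\<lambda>y. \<bar>k y\<bar> * (L1_norm k * B))" using k by simp
      show "AE y in lborel. ((\<lambda>\<epsilon>. k y * (\<integral>x. k x * c (\<epsilon> * (x - y)) \<partial>lborel)) \<longlongrightarrow> k y * c 0) (at_right 0)"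
        by (intro AE_I2 tendsto_intros inner_lim)
      show "AE y in lborel. \<bar>k y * (\<integral>x. k x * c (\<epsilon> * (x - y)) \<partial>lborel)\<bar> \<le> \<bar>k y\<bar> * (L1_norm k * B)" for \<epsilon>
        using inner_bound by (intro AE_I2) (simp add: abs_mult mult_left_mono)
    qed measurable
    then show ?thesis using k(2) by simp
  qed
  have expand: "(L2_norm (\<lambda>x. fun_convolution (dilate \<epsilon> k) f x - f x))\<^sup>2 =
      (\<integral>y. k y * (\<integral>x. k x * c (\<epsilon> * (x - y)) \<partial>lborel) \<partial>lborel)
      - 2 * (\<integral>x. k x * c (\<epsilon> * (x - 0)) \<partial>lborel) + c 0" if \<epsilon>: "0 < \<epsilon>" for \<epsilon>
  proof -
    have k\<epsilon>: "integrable lborel (dilate \<epsilon> k)" using k(1) \<epsilon> by (rule dilate_integrable)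
    let ?K = "fun_convolution (dilate \<epsilon> k) f"
    have K: "?K \<in> L2_space" by (rule fun_convolution_L2[OF k\<epsilon> f])
    have pair: "L2_inner ?K h = (\<integral>x. k x * correlation f h (\<epsilon> * x) \<partial>lborel)" if h: "h \<in> L2_space" for h
      using L2_inner_fun_convolution[OF k\<epsilon> f h] integral_dilate[OF \<epsilon>, of k "correlation f h"] by simp
    \<comment> \<open>The same formula applied to a translate of \<open>f\<close>: this resolves the inner product of the convolution with itself.\<close>
    have "correlation f ?K (\<epsilon> * y) = (\<integral>x. k x * c (\<epsilon> * (x - y)) \<partial>lborel)" for y
      using pair[OF L2_shift[OF f, of "\<epsilon> * y"]]
      unfolding correlation_def[of f ?K] L2_inner_commute[of _ ?K]
      by (simp add: correlation_shift_right c_def right_diff_distrib)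
    then have "L2_inner ?K ?K = (\<integral>y. k y * (\<integral>x. k x * c (\<epsilon> * (x - y)) \<partial>lborel) \<partial>lborel)"
      by (simp add: pair[OF K])
    then show ?thesis
      using L2_norm_diff_square[OF K f] pair[OF f] by (simp add: c_def correlation_zero)
  qed
  have "\<forall>\<^sub>F \<epsilon> in at_right 0. (\<integral>y. k y * (\<integral>x. k x * c (\<epsilon> * (x - y)) \<partial>lborel) \<partial>lborel)
      - 2 * (\<integral>x. k x * c (\<epsilon> * (x - 0)) \<partial>lborel) + c 0
      = (L2_norm (\<lambda>x. fun_convolution (dilate \<epsilon> k) f x - f x))\<^sup>2"
    unfolding eventually_at_filter by (intro always_eventually) (use expand in fastforce)
  moreover have "((\<lambda>\<epsilon>. (\<integral>y. k y * (\<integral>x. k x * c (\<epsilon> * (x - y)) \<partial>lborel) \<partial>lborel)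
      - 2 * (\<integral>x. k x * c (\<epsilon> * (x - 0)) \<partial>lborel) + c 0) \<longlongrightarrow> c 0 - 2 * c 0 + c 0) (at_right 0)"
    by (intro tendsto_intros outer_lim inner_lim)
  ultimately have "((\<lambda>\<epsilon>. (L2_norm (\<lambda>x. fun_convolution (dilate \<epsilon> k) f x - f x))\<^sup>2) \<longlongrightarrow> c 0 - 2 * c 0 + c 0) (at_right 0)"
    by (rule Lim_transform_eventually[rotated])
  then have "((\<lambda>\<epsilon>. (L2_norm (\<lambda>x. fun_convolution (dilate \<epsilon> k) f x - f x))\<^sup>2) \<longlongrightarrow> 0) (at_right 0)"
    by simp
  then have "((\<lambda>\<epsilon>. sqrt ((L2_norm (\<lambda>x. fun_convolution (dilate \<epsilon> k) f x - f x))\<^sup>2)) \<longlongrightarrow> sqrt 0) (at_right 0)"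
    by (rule tendsto_real_sqrt)
  then show ?thesis by (simp add: L2_norm_nonneg)
qed

section \<open>Test functions and weak derivatives\<close>

text \<open>One term of the exponential series, used to see that $t^k e^{-t}$ is bounded on the positive half-line.\<close>

lemma power_le_fact_mult_exp: "t ^ k \<le> fact k * exp t" if "0 \<le> t" for t :: real
proof -
  have s: "(\<lambda>n. t ^ n /\<^sub>R fact n) sums exp t" by (rule exp_converges)
  have "(\<Sum>n\<in>{k}. t ^ n /\<^sub>R fact n) \<le> (\<Sum>n. t ^ n /\<^sub>R fact n)"
    using that by (intro sum_le_suminf sums_summable[OF s]) auto
  then show ?thesis using sums_unique[OF s] by (simp add: divide_simps mult.commute)
qed

text \<open>For \<open>m = 0\<close> and \<open>p = 1\<close> this is the standard bump function. The parameters make the family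
  closed under differentiation, so that smoothness follows from differentiability of every member.\<close>

definition flat_bump :: "nat \<Rightarrow> real poly \<Rightarrow> real \<Rightarrow> real" where
  "flat_bump m p x =
     (if \<bar>x\<bar> < 1 then poly p x / (1 - x\<^sup>2) ^ m * exp (- 1 / (1 - x\<^sup>2)) else 0)"

text \<open>Quadratic decay at the endpoints is what makes the derivative exist, and vanish, there.\<close>

lemma flat_bump_bound: "\<exists>C. \<forall>x. \<bar>flat_bump m p x\<bar> \<le> C * (1 - \<bar>x\<bar>)\<^sup>2"
proof -
  have "compact (poly p ` {-1..1::real})"
    by (intro compact_continuous_image continuous_on_poly continuous_on_id compact_Icc)
  then have "bounded (poly p ` {-1..1::real})" by (rule compact_imp_bounded)
  then obtain D where D: "\<And>x. \<bar>x\<bar> \<le> 1 \<Longrightarrow> \<bar>poly p x\<bar> \<le> D"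
    unfolding bounded_iff by (metis abs_le_iff atLeastAtMost_iff imageI minus_le_iff real_norm_def)
  have D0: "0 \<le> D" using D[of 0] by simp
  show ?thesis
  proof (intro exI allI)
    fix x :: real
    show "\<bar>flat_bump m p x\<bar> \<le> (D * fact (m + 2) * 4) * (1 - \<bar>x\<bar>)\<^sup>2"
    proof (cases "\<bar>x\<bar> < 1")
      case True
      define s t where "s = 1 - x\<^sup>2" and "t = 1 / s"
      have s: "0 < s" using True by (simp add: s_def abs_square_less_1)
      have ts: "t * s = 1" using s by (simp add: t_def)
      \<comment> \<open>The exponent exceeds \<open>m\<close> by two in order to leave a factor \<open>s\<^sup>2\<close>.\<close>
      have "t ^ (m + 2) * exp (- t) \<le> fact (m + 2)"
        using mult_right_mono[OF power_le_fact_mult_exp[of t "m + 2"], of "exp (- t)"] s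
        by (simp add: t_def mult.assoc flip: exp_add)
      then have "t ^ (m + 2) * exp (- t) * s\<^sup>2 \<le> fact (m + 2) * s\<^sup>2" by (intro mult_right_mono) auto
      moreover have "t ^ (m + 2) * exp (- t) * s\<^sup>2 = t ^ m * exp (- t) * (t * s)\<^sup>2"
        by (simp only: power_add power_mult_distrib ac_simps)
      ultimately have 1: "t ^ m * exp (- t) \<le> fact (m + 2) * s\<^sup>2"
        by (simp only: ts power_one mult_1_right)
      have "s = (1 - \<bar>x\<bar>) * (1 + \<bar>x\<bar>)" by (simp add: s_def power2_eq_square algebra_simps)
      also have "\<dots> \<le> (1 - \<bar>x\<bar>) * 2" using True by (intro mult_left_mono) auto
      finally have "s\<^sup>2 \<le> ((1 - \<bar>x\<bar>) * 2)\<^sup>2" using s by (intro power_mono) auto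
      then have 2: "s\<^sup>2 \<le> 4 * (1 - \<bar>x\<bar>)\<^sup>2" by (simp only: power_mult_distrib) (simp add: mult.commute)
      have "\<bar>flat_bump m p x\<bar> = \<bar>poly p x\<bar> * (t ^ m * exp (- t))"
        using True s by (simp add: flat_bump_def t_def abs_mult power_divide flip: s_def)
      also have "\<dots> \<le> D * (fact (m + 2) * s\<^sup>2)"
        using True s by (intro mult_mono[OF D 1 D0]) (simp_all add: t_def)
      also have "\<dots> \<le> D * (fact (m + 2) * (4 * (1 - \<bar>x\<bar>)\<^sup>2))"
        using 2 D0 by (intro mult_left_mono) auto
      finally show ?thesis by (simp add: mult.assoc)
    qed (use D0 in \<open>simp add: flat_bump_def\<close>)
  qed
qed

lemma flat_bump_has_derivative:
  "(flat_bump m p has_real_derivative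
     flat_bump (m + 2) (pderiv p * [:1, 0, -1:]\<^sup>2 + smult (2 * of_nat m) ([:0, 1:] * p * [:1, 0, -1:])
       - smult 2 ([:0, 1:] * p)) x) (at x)"
  (is "(_ has_real_derivative flat_bump _ ?q x) _")
proof -
  consider "\<bar>x\<bar> < 1" | "\<bar>x\<bar> = 1" | "1 < \<bar>x\<bar>" by linarith
  then show ?thesis
  proof cases
    case 1
    define s where "s = 1 - x\<^sup>2"
    have s: "0 < s" using 1 by (simp add: s_def abs_square_less_1)
    have A: "((\<lambda>x. 1 - x\<^sup>2) has_real_derivative - 2 * x) (at x)"
      by (auto intro!: derivative_eq_intros)
    have "((\<lambda>x. - 1 / (1 - x\<^sup>2)) has_real_derivative (0 * (1 - x\<^sup>2) - (-1) * (- 2 * x)) / ((1 - x\<^sup>2) * (1 - x\<^sup>2))) (at x)"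
      by (intro DERIV_divide A DERIV_const) (use s in \<open>simp add: s_def\<close>)
    then have "((\<lambda>x. - 1 / (1 - x\<^sup>2)) has_real_derivative - 2 * x / s\<^sup>2) (at x)"
      by (simp add: s_def power2_eq_square[of "1 - x\<^sup>2"])
    from DERIV_chain2[OF DERIV_exp this]
    have E: "((\<lambda>x. exp (- 1 / (1 - x\<^sup>2))) has_real_derivative exp (- 1 / s) * (- 2 * x / s\<^sup>2)) (at x)"
      by (simp add: s_def)
    have Q: "((\<lambda>x. poly p x / (1 - x\<^sup>2) ^ m) has_real_derivative
        (poly (pderiv p) x * (1 - x\<^sup>2) ^ m - poly p x * (of_nat m * ((- 2 * x) * (1 - x\<^sup>2) ^ (m - Suc 0))))
          / ((1 - x\<^sup>2) ^ m * (1 - x\<^sup>2) ^ m)) (at x)"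
      by (intro DERIV_divide DERIV_power poly_DERIV A) (use s in \<open>simp add: s_def\<close>)
    have "((\<lambda>x. poly p x / (1 - x\<^sup>2) ^ m * exp (- 1 / (1 - x\<^sup>2))) has_real_derivative
        (poly (pderiv p) x * s ^ m - poly p x * (of_nat m * (- (2 * x)) * s ^ (m - 1))) / (s ^ m * s ^ m)
          * exp (- 1 / s) + exp (- 1 / s) * (- 2 * x / s\<^sup>2) * (poly p x / s ^ m)) (at x)"
      using DERIV_mult[OF Q E] by (simp only: flip: s_def) (simp add: mult.assoc)
    also have "(poly (pderiv p) x * s ^ m - poly p x * (of_nat m * (- (2 * x)) * s ^ (m - 1))) / (s ^ m * s ^ m)
          * exp (- 1 / s) + exp (- 1 / s) * (- 2 * x / s\<^sup>2) * (poly p x / s ^ m)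
        = (poly (pderiv p) x * s\<^sup>2 + 2 * of_nat m * x * poly p x * s - 2 * x * poly p x) / s ^ (m + 2)
          * exp (- 1 / s)"
      using s by (cases m) (simp_all add: divide_simps power2_eq_square, simp_all add: algebra_simps power2_eq_square)
    also have "\<dots> = flat_bump (m + 2) ?q x"
      using 1 by (simp add: flat_bump_def s_def algebra_simps power2_eq_square)
    finally have "((\<lambda>x. poly p x / (1 - x\<^sup>2) ^ m * exp (- 1 / (1 - x\<^sup>2))) has_real_derivative
        flat_bump (m + 2) ?q x) (at x)" .
    then show ?thesis
      by (rule has_field_derivative_transform_within_open[where S = "{-1<..<1}"])
         (use 1 in \<open>auto simp: flat_bump_def\<close>)
  next
    case 2
    obtain C where C: "\<And>x. \<bar>flat_bump m p x\<bar> \<le> C * (1 - \<bar>x\<bar>)\<^sup>2" using flat_bump_bound by blast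
    have C0: "0 \<le> C" using C[of 0] abs_ge_zero order_trans by fastforce
    have "((\<lambda>y. flat_bump m p y / (y - x)) \<longlongrightarrow> 0) (at x)"
    proof (rule Lim_null_comparison)
      show "\<forall>\<^sub>F y in at x. norm (flat_bump m p y / (y - x)) \<le> C * \<bar>y - x\<bar>"
      proof (rule eventually_at_filter[THEN iffD2, OF always_eventually], intro allI impI)
        fix y assume y: "y \<noteq> x"
        have "\<bar>1 - \<bar>y\<bar>\<bar> \<le> \<bar>y - x\<bar>" using 2 by linarith
        then have "(1 - \<bar>y\<bar>)\<^sup>2 \<le> (y - x)\<^sup>2" by (simp add: abs_le_square_iff)
        then have "\<bar>flat_bump m p y\<bar> \<le> C * \<bar>y - x\<bar>\<^sup>2"
          using C[of y] mult_left_mono[OF _ C0] by (fastforce intro: order_trans)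
        then show "norm (flat_bump m p y / (y - x)) \<le> C * \<bar>y - x\<bar>"
          using y by (simp add: divide_simps power2_eq_square mult.assoc abs_mult)
      qed
      have "((\<lambda>y. C * \<bar>y - x\<bar>) \<longlongrightarrow> C * \<bar>x - x\<bar>) (at x)" by (intro tendsto_intros)
      then show "((\<lambda>y. C * \<bar>y - x\<bar>) \<longlongrightarrow> 0) (at x)" by simp
    qed
    then show ?thesis using 2 by (simp add: has_field_derivative_iff flat_bump_def)
  next
    case 3
    have "((\<lambda>_. 0) has_real_derivative 0) (at x)" by simp
    then have "(flat_bump m p has_real_derivative 0) (at x)"
      by (rule has_field_derivative_transform_within_open[where S = "{..<-1} \<union> {1<..}"])
         (use 3 in \<open>auto simp: flat_bump_def\<close>)
    then show ?thesis using 3 by (simp add: flat_bump_def)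
  qed
qed

lemma flat_bump_higher_deriv: "\<exists>m' p'. (deriv ^^ k) (flat_bump m p) = flat_bump m' p'"
proof (induction k)
  case (Suc k)
  then obtain m' p' where "(deriv ^^ k) (flat_bump m p) = flat_bump m' p'" by blast
  then have "(deriv ^^ Suc k) (flat_bump m p) = deriv (flat_bump m' p')" by simp
  also have "\<dots> = flat_bump (m' + 2) (pderiv p' * [:1, 0, -1:]\<^sup>2 + smult (2 * of_nat m') ([:0, 1:] * p' * [:1, 0, -1:])
       - smult 2 ([:0, 1:] * p'))"
    using flat_bump_has_derivative by (blast intro: DERIV_imp_deriv)
  finally show ?case by blast
qed auto

lemma test_function_flat_bump: "test_function (flat_bump m p)"
  unfolding test_function_def
proof
  show "\<forall>k x. (deriv ^^ k) (flat_bump m p) differentiable at x"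
    using flat_bump_higher_deriv flat_bump_has_derivative real_differentiable_def by metis
  show "\<exists>R. \<forall>x. R < \<bar>x\<bar> \<longrightarrow> flat_bump m p x = 0"
    by (intro exI[of _ 1]) (simp add: flat_bump_def)
qed

text \<open>Translates and dilates of test functions are needed for moving derivatives through convolutions and for
  mollification.\<close>

lemma higher_deriv_affine:
  assumes "\<And>k x. (deriv ^^ k) \<psi> differentiable at (x::real)"
  shows "(deriv ^^ k) (\<lambda>x. c * \<psi> (a * x + b)) = (\<lambda>x. c * a ^ k * (deriv ^^ k) \<psi> (a * x + b))"
proof (induction k)
  case (Suc k)
  have D: "((deriv ^^ k) \<psi> has_real_derivative (deriv ^^ Suc k) \<psi> y) (at y)" for y
    using assms[of k y] by (simp add: DERIV_deriv_iff_real_differentiable)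
  have "((\<lambda>x. c * a ^ k * (deriv ^^ k) \<psi> (a * x + b)) has_real_derivative
      c * a ^ k * ((deriv ^^ Suc k) \<psi> (a * x + b) * a)) (at x)" for x
    by (intro DERIV_cmult DERIV_chain2[OF D]) (auto intro!: derivative_eq_intros)
  then have "deriv (\<lambda>x. c * a ^ k * (deriv ^^ k) \<psi> (a * x + b)) =
      (\<lambda>x. c * a ^ k * ((deriv ^^ Suc k) \<psi> (a * x + b) * a))"
    by (blast intro: DERIV_imp_deriv)
  then show ?case using Suc by (simp add: ac_simps)
qed simp

lemma test_function_affine:
  assumes \<psi>: "test_function \<psi>" and a: "a \<noteq> 0"
  shows "test_function (\<lambda>x. c * \<psi> (a * x + b))"
proof -
  have diff: "\<And>k x. (deriv ^^ k) \<psi> differentiable at x" using \<psi> by (simp add: test_function_def)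
  obtain R where R: "\<And>x. R < \<bar>x\<bar> \<Longrightarrow> \<psi> x = 0" using \<psi> by (auto simp: test_function_def)
  have "(deriv ^^ k) (\<lambda>x. c * \<psi> (a * x + b)) differentiable at x" for k x
  proof -
    have D: "((deriv ^^ k) \<psi> has_real_derivative (deriv ^^ Suc k) \<psi> y) (at y)" for y
      using diff[of k y] by (simp add: DERIV_deriv_iff_real_differentiable)
    have "((\<lambda>x. c * a ^ k * (deriv ^^ k) \<psi> (a * x + b)) has_real_derivative
        c * a ^ k * ((deriv ^^ Suc k) \<psi> (a * x + b) * a)) (at x)"
      by (intro DERIV_cmult DERIV_chain2[OF D]) (auto intro!: derivative_eq_intros)
    then show ?thesis unfolding higher_deriv_affine[OF diff] real_differentiable_def by blast
  qed
  moreover have "\<psi> (a * x + b) = 0" if "(\<bar>R\<bar> + \<bar>b\<bar>) / \<bar>a\<bar> < \<bar>x\<bar>" for x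
  proof (rule R)
    have "\<bar>R\<bar> + \<bar>b\<bar> < \<bar>a * x\<bar>" using that a by (simp add: divide_simps abs_mult mult.commute)
    then show "R < \<bar>a * x + b\<bar>" by linarith
  qed
  ultimately show ?thesis unfolding test_function_def by (metis mult_zero_right)
qed

lemma test_function_deriv:
  assumes \<psi>: "test_function \<psi>"
  shows "test_function (deriv \<psi>)"
proof -
  obtain R where R: "\<And>x. R < \<bar>x\<bar> \<Longrightarrow> \<psi> x = 0" using \<psi> by (auto simp: test_function_def)
  have "deriv \<psi> x = 0" if "\<bar>R\<bar> < \<bar>x\<bar>" for x
  proof (rule DERIV_imp_deriv)
    have "((\<lambda>_. 0) has_real_derivative 0) (at x)" by simp
    then show "(\<psi> has_real_derivative 0) (at x)"
      by (rule has_field_derivative_transform_within_open[where S = "{..< -\<bar>R\<bar>} \<union> {\<bar>R\<bar><..}"])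
         (use that R in \<open>auto simp: abs_if split: if_splits\<close>)
  qed
  moreover have "(deriv ^^ k) (deriv \<psi>) differentiable at x" for k x
    using \<psi> unfolding test_function_def by (metis funpow_Suc_right comp_apply)
  ultimately show ?thesis unfolding test_function_def by blast
qed

lemma test_function_higher_deriv: "test_function \<psi> \<Longrightarrow> test_function ((deriv ^^ k) \<psi>)"
  by (induction k) (auto intro: test_function_deriv)

lemma test_function_has_derivative:
  assumes "test_function \<psi>"
  shows "(\<psi> has_real_derivative deriv \<psi> x) (at x)"
proof -
  have "(deriv ^^ 0) \<psi> differentiable at x" using assms unfolding test_function_def by blast
  then show ?thesis by (simp add: DERIV_deriv_iff_real_differentiable)
qed

lemma test_function_continuous: "test_function \<psi> \<Longrightarrow> continuous_on A \<psi>"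
  by (intro continuous_at_imp_continuous_on ballI DERIV_isCont[OF test_function_has_derivative])

lemma test_function_bounded:
  assumes \<psi>: "test_function \<psi>"
  obtains R B where "\<And>x. R < \<bar>x\<bar> \<Longrightarrow> \<psi> x = 0" "\<And>x. \<bar>\<psi> x\<bar> \<le> B"
proof -
  obtain R where R: "\<And>x. R < \<bar>x\<bar> \<Longrightarrow> \<psi> x = 0" using \<psi> by (auto simp: test_function_def)
  have "compact (\<psi> ` {-R..R})"
    using \<psi> by (intro compact_continuous_image test_function_continuous compact_Icc)
  then have "bounded (\<psi> ` {-R..R})" by (rule compact_imp_bounded)
  then obtain D where D: "\<And>x. x \<in> {-R..R} \<Longrightarrow> \<bar>\<psi> x\<bar> \<le> D"
    unfolding bounded_iff by (metis imageI real_norm_def)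
  have "\<bar>\<psi> x\<bar> \<le> \<bar>D\<bar>" for x using D[of x] R[of x] by (cases "R < \<bar>x\<bar>") (auto simp: not_less abs_le_iff)
  with R that show thesis by blast
qed

lemma test_function_L2:
  assumes "test_function \<psi>"
  shows "\<psi> \<in> L2_space"
proof -
  obtain R B where "\<And>x. R < \<bar>x\<bar> \<Longrightarrow> \<psi> x = 0" "\<And>x. \<bar>\<psi> x\<bar> \<le> B"
    using test_function_bounded[OF assms] by blast
  moreover have "\<psi> \<in> borel_measurable borel"
    using test_function_continuous[OF assms] by (rule borel_measurable_continuous_onI)
  ultimately show ?thesis by (intro L2_bounded_support)
qed

lemma test_function_integrable:
  assumes "test_function \<psi>"
  shows "integrable lborel \<psi>"
proof -
  obtain R B where R: "\<And>x. R < \<bar>x\<bar> \<Longrightarrow> \<psi> x = 0" "\<And>x. \<bar>\<psi> x\<bar> \<le> B"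
    using test_function_bounded[OF assms] by blast
  have "set_integrable lborel {-R..R} \<psi>"
    using test_function_continuous[OF assms] by (rule borel_integrable_atLeastAtMost')
  moreover have "(\<lambda>x. indicator {-R..R} x *\<^sub>R \<psi> x) = \<psi>"
    using R by (force split: split_indicator)
  ultimately show ?thesis by (simp add: set_integrable_def)
qed

text \<open>The integral of the derivative of $\psi(x) e^{i \xi x}$ over an interval containing the support vanishes.\<close>

lemma fourier_deriv:
  assumes \<psi>: "test_function \<psi>"
  shows "fourier (deriv \<psi>) \<xi> = - \<i> * \<xi> * fourier \<psi> \<xi>"
proof -
  have \<psi>': "test_function (deriv \<psi>)" using \<psi> by (rule test_function_deriv)
  obtain R B where R: "\<And>x. R < \<bar>x\<bar> \<Longrightarrow> \<psi> x = 0" "\<And>x. \<bar>\<psi> x\<bar> \<le> B"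
    using test_function_bounded[OF \<psi>] by blast
  obtain R' B' where R': "\<And>x. R' < \<bar>x\<bar> \<Longrightarrow> deriv \<psi> x = 0" "\<And>x. \<bar>deriv \<psi> x\<bar> \<le> B'"
    using test_function_bounded[OF \<psi>'] by blast
  define r where "r = max 0 (max R R') + 1"
  let ?F = "\<lambda>x. \<psi> x *\<^sub>R iexp (\<xi> * x)"
  let ?f = "\<lambda>x. deriv \<psi> x *\<^sub>R iexp (\<xi> * x) + (\<i> * \<xi>) * (\<psi> x *\<^sub>R iexp (\<xi> * x))"
  have "integral\<^sup>L lborel (\<lambda>x. indicator {-r..r} x *\<^sub>R ?f x) = ?F r - ?F (-r)"
  proof (rule integral_FTC_atLeastAtMost)
    show "- r \<le> r" by (simp add: r_def)
    show "(?F has_vector_derivative ?f x) (at x within {-r..r})" for x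
    proof -
      have 1: "(\<psi> has_real_derivative deriv \<psi> x) (at x within {-r..r})"
        using test_function_has_derivative[OF \<psi>] by (rule has_field_derivative_at_within)
      have "((\<lambda>x. exp (\<i> * complex_of_real (\<xi> * x))) has_vector_derivative (\<i> * \<xi>) * iexp (\<xi> * x)) (at x within {-r..r})"
      proof -
        have "((\<lambda>z. exp (\<i> * (complex_of_real \<xi> * z))) has_field_derivative (\<i> * \<xi>) * iexp (\<xi> * x))
            (at (complex_of_real x))"
          by (auto intro!: derivative_eq_intros)
        from has_vector_derivative_real_field[OF this] show ?thesis by simp
      qed
      from has_vector_derivative_scaleR[OF 1 this] show ?thesis
        by (simp add: algebra_simps)
    qed
    show "continuous_on {-r..r} ?f"
      by (intro continuous_intros test_function_continuous \<psi> \<psi>')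
  qed
  moreover have "?F r = 0" "?F (-r) = 0" using R(1)[of r] R(1)[of "-r"] by (auto simp: r_def)
  moreover have "(\<lambda>x. indicator {-r..r} x *\<^sub>R ?f x) = ?f"
  proof
    fix x
    show "indicator {-r..r} x *\<^sub>R ?f x = ?f x"
      using R(1)[of x] R'(1)[of x] by (cases "\<bar>x\<bar> \<le> r") (auto simp: r_def split: split_indicator)
  qed
  ultimately have "(\<integral>x. ?f x \<partial>lborel) = 0" by simp
  moreover have "(\<integral>x. ?f x \<partial>lborel) = fourier (deriv \<psi>) \<xi> + (\<i> * \<xi>) * fourier \<psi> \<xi>"
  proof -
    have i: "integrable lborel (\<lambda>x. deriv \<psi> x *\<^sub>R iexp (\<xi> * x))"
      "integrable lborel (\<lambda>x. (\<i> * \<xi>) * (\<psi> x *\<^sub>R iexp (\<xi> * x)))"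
      using \<psi> \<psi>' by (intro integrable_mult_right fourier_integrable test_function_integrable; simp)+
    show ?thesis
      unfolding fourier_scaleR Bochner_Integration.integral_add[OF i] by (simp only: integral_mult_right_zero)
  qed
  ultimately show ?thesis by (simp add: add_eq_0_iff)
qed

lemma fourier_higher_deriv:
  assumes "test_function \<psi>"
  shows "fourier ((deriv ^^ k) \<psi>) \<xi> = (- \<i> * \<xi>) ^ k * fourier \<psi> \<xi>"
proof (induction k)
  case (Suc k)
  then show ?case
    using fourier_deriv[OF test_function_higher_deriv[OF assms, of k]] by simp
qed simp

text \<open>A convolution is an average of translates, and the translates of a test function are test functions, so
  the weak equation for \<open>f\<close> and \<open>g\<close> may be applied to each translate separately.\<close>

lemma weak_derivative_fun_convolution:
  assumes k: "integrable lborel k" and f: "f \<in> L2_space" and g: "g \<in> L2_space"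
    and weak: "\<And>\<psi>. test_function \<psi> \<Longrightarrow> L2_inner g \<psi> = s * L2_inner f ((deriv ^^ m) \<psi>)"
    and \<psi>: "test_function \<psi>"
  shows "L2_inner (fun_convolution k g) \<psi> = s * L2_inner (fun_convolution k f) ((deriv ^^ m) \<psi>)"
proof -
  have diff: "\<And>k x. (deriv ^^ k) \<psi> differentiable at x" using \<psi> by (simp add: test_function_def)
  have "correlation g \<psi> y = s * correlation f ((deriv ^^ m) \<psi>) y" for y
  proof -
    have "correlation g \<psi> y = L2_inner g (\<lambda>x. 1 * \<psi> (1 * x + y))"
      by (simp add: correlation_def L2_inner_shift_move)
    also have "\<dots> = s * L2_inner f ((deriv ^^ m) (\<lambda>x. 1 * \<psi> (1 * x + y)))"
      by (intro weak test_function_affine \<psi>) simp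
    also have "\<dots> = s * correlation f ((deriv ^^ m) \<psi>) y"
      unfolding higher_deriv_affine[OF diff] by (simp add: correlation_def L2_inner_shift_move)
    finally show ?thesis .
  qed
  then show ?thesis
    using test_function_L2[OF \<psi>] test_function_L2[OF test_function_higher_deriv[OF \<psi>, of m]]
    by (simp add: L2_inner_fun_convolution k f g mult.left_commute[of _ s])
qed

text \<open>Mollifying \<open>a\<close> with a dilated bump function gives at each point the pairing of \<open>a\<close> with a
  test function, hence zero; but the mollifications converge to \<open>a\<close>.\<close>

lemma L2_eq_0_of_test_functions:
  assumes a: "a \<in> L2_space" and zero: "\<And>\<psi>. test_function \<psi> \<Longrightarrow> L2_inner a \<psi> = 0"
  shows "AE x in lborel. a x = 0"
proof -
  define c where "c = (\<integral>x. flat_bump 0 1 x \<partial>lborel)"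
  define \<rho> where "\<rho> = (\<lambda>x. 1 / c * flat_bump 0 1 (1 * x + 0))"
  have int: "integrable lborel (flat_bump 0 1)"
    by (intro test_function_integrable test_function_flat_bump)
  have nonneg: "0 \<le> flat_bump 0 1 x" for x by (simp add: flat_bump_def)
  have "c \<noteq> 0"
  proof
    assume "c = 0"
    then have "AE x in lborel. flat_bump 0 1 x = 0"
      using integral_nonneg_eq_0_iff_AE[OF int] nonneg by (simp add: c_def)
    then have "AE x in lborel. x \<notin> {-1<..<1::real}"
      by eventually_elim (auto simp: flat_bump_def abs_if split: if_splits)
    then have "emeasure lborel {-1<..<1::real} = 0"
      by (subst (asm) AE_iff_measurable[OF _ refl]) (auto simp: greaterThanLessThan_def greaterThan_def lessThan_def Int_def)
    then show False by simp
  qed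
  have \<rho>: "test_function \<rho>"
    unfolding \<rho>_def by (intro test_function_affine test_function_flat_bump) simp
  have \<rho>1: "(\<integral>x. \<rho> x \<partial>lborel) = 1" using \<open>c \<noteq> 0\<close> by (simp add: \<rho>_def flip: c_def)
  have \<rho>i: "integrable lborel \<rho>" using \<rho> by (rule test_function_integrable)
  have conv: "fun_convolution (dilate \<epsilon> \<rho>) a = (\<lambda>x. 0)" if \<epsilon>: "0 < \<epsilon>" for \<epsilon>
  proof
    fix x
    have "fun_convolution (dilate \<epsilon> \<rho>) a x = (\<integral>y. dilate \<epsilon> \<rho> (x - y) * a (x - (x - y)) \<partial>lborel)"
      unfolding fun_convolution_def
      using lborel_integral_reflect[of "\<lambda>y. dilate \<epsilon> \<rho> y * a (x - y)" x] by simp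
    also have "\<dots> = L2_inner a (\<lambda>y. 1 / \<epsilon> * \<rho> (- 1 / \<epsilon> * y + x / \<epsilon>))"
      by (simp add: L2_inner_def dilate_def diff_divide_distrib mult.commute)
    also have "\<dots> = 0"
      by (intro zero test_function_affine \<rho>) (use \<epsilon> in simp)
    finally show "fun_convolution (dilate \<epsilon> \<rho>) a x = 0" .
  qed
  have "((\<lambda>\<epsilon>. L2_norm (\<lambda>x. fun_convolution (dilate \<epsilon> \<rho>) a x - a x)) \<longlongrightarrow> 0) (at_right 0)"
    by (rule approximate_identity[OF \<rho>i \<rho>1 a])
  moreover have "\<forall>\<^sub>F \<epsilon> in at_right 0. L2_norm (\<lambda>x. fun_convolution (dilate \<epsilon> \<rho>) a x - a x) = L2_norm a"
    unfolding eventually_at_filter by (intro always_eventually) (auto simp: conv L2_norm_minus)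
  ultimately have "((\<lambda>\<epsilon>::real. L2_norm a) \<longlongrightarrow> 0) (at_right 0)"
    by (rule Lim_transform_eventually)
  then have "L2_norm a = 0" by (simp add: tendsto_const_iff)
  with a show ?thesis by (rule L2_norm_zero_imp_AE)
qed

section \<open>The fundamental solution\<close>

text \<open>A nonempty open set is not negligible.\<close>

lemma continuous_AE_eq_imp_eq:
  fixes f g :: "real \<Rightarrow> real"
  assumes f: "continuous_on UNIV f" and g: "continuous_on UNIV g" and eq: "AE x in lborel. f x = g x"
  shows "f = g"
proof -
  have op: "open {x. f x \<noteq> g x}" using open_Collect_neq[OF f g] .
  have "AE x in lborel. x \<notin> {x. f x \<noteq> g x}" using eq by simp
  then have "emeasure lborel {x. f x \<noteq> g x} = 0"
    using AE_iff_measurable[of "{x. f x \<noteq> g x}" lborel "\<lambda>x. f x = g x"] op eq by auto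
  then have "negligible {x. f x \<noteq> g x}"
    unfolding negligible_iff_null_sets using op
    by (intro null_sets_completionI) (auto simp: null_sets_def)
  then have "{x. f x \<noteq> g x} = {}" using open_not_negligible[OF op] by blast
  then show ?thesis by auto
qed

lemma fourier_dilate:
  assumes "0 < \<epsilon>"
  shows "fourier (dilate \<epsilon> k) \<xi> = fourier k (\<epsilon> * \<xi>)"
  using integral_dilate[OF assms, of k "\<lambda>x. iexp (\<xi> * x)"]
  by (simp add: fourier_scaleR mult.left_commute mult.commute mult.assoc)

lemma fourier_reflect: "fourier (\<lambda>x. k (- x)) \<xi> = fourier k (- \<xi>)"
  using lborel_integral_reflect[of "\<lambda>x. k x *\<^sub>R iexp (- \<xi> * x)" 0] by (simp add: fourier_scaleR)

locale heat_kernel =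
  fixes n :: nat and u :: "real \<Rightarrow> real \<Rightarrow> real"
  assumes n_pos: "n \<ge> 1" and fundamental: "fundamental_solution n u"
begin

lemma u_nonpos: "w \<le> 0 \<Longrightarrow> u x w = 0"
  using fundamental by (simp add: fundamental_solution_def)

lemma u_integrable: "integrable lborel (\<lambda>x. u x w)"
  using fundamental u_nonpos by (cases "w \<le> 0") (simp_all add: fundamental_solution_def)

lemma u_fourier: "w > 0 \<Longrightarrow> fourier (\<lambda>x. u x w) \<xi> = complex_of_real (exp (- (\<xi> ^ (2 * n)) * w))"
  using fundamental by (simp add: fundamental_solution_def spectral_function_def)

lemma u_continuous: "w > 0 \<Longrightarrow> continuous_on UNIV (\<lambda>x. u x w)"
proof (intro continuous_at_imp_continuous_on ballI)
  fix x assume "w > 0"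
  then have "(deriv ^^ 0) (\<lambda>y. u y w) differentiable at x"
    using fundamental n_pos unfolding fundamental_solution_def by force
  then show "isCont (\<lambda>x. u x w) x" by (simp add: differentiable_imp_continuous_within)
qed

text \<open>The transform is even. Equality of transforms gives equality almost everywhere, and continuity in
  \<open>x\<close> upgrades it to every point.\<close>

lemma u_even: "u (- x) w = u x w"
proof (cases "0 < w")
  case True
  have "integrable lborel (\<lambda>x. u (- x) w)"
    using lborel_integrable_real_affine[OF u_integrable[of w], of "-1" 0] by simp
  moreover have "fourier (\<lambda>x. u (- x) w) \<xi> = fourier (\<lambda>x. u x w) \<xi>" for \<xi>
    by (simp add: fourier_reflect[of "\<lambda>x. u x w"] u_fourier[OF True])
  ultimately have "AE x in lborel. u (- x) w = u x w"
    by (intro fourier_injective u_integrable)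
  then have "(\<lambda>x. u (- x) w) = (\<lambda>x. u x w)"
    by (intro continuous_AE_eq_imp_eq continuous_on_compose2[OF u_continuous[OF True]] u_continuous[OF True]
        continuous_intros) auto
  then show ?thesis by (rule fun_cong)
qed (simp add: u_nonpos)

text \<open>The width of \<open>u\<close> at time \<open>w\<close>: the equation is invariant under
  $(x, w) \mapsto (\lambda x, \lambda^{2n} w)$.\<close>

definition heat_scale :: "real \<Rightarrow> real" where
  "heat_scale w = w powr (1 / real (2 * n))"

lemma heat_scale_pos: "0 < w \<Longrightarrow> 0 < heat_scale w"
  by (simp add: heat_scale_def)

lemma heat_scale_power: "0 < w \<Longrightarrow> heat_scale w ^ (2 * n) = w"
  using n_pos by (simp add: heat_scale_def powr_power)

lemma heat_scale_measurable[measurable]: "heat_scale \<in> borel_measurable borel"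
  unfolding heat_scale_def[abs_def] by measurable

text \<open>Self-similarity. It holds at every point and not only almost everywhere, which gives joint measurability of
  \<open>u\<close>; it also makes the $L^1$ norm independent of time and turns the limit \<open>w \<rightarrow> 0\<close>
  into an approximate identity.\<close>

lemma u_scaling:
  assumes w: "0 < w"
  shows "u x w = dilate (heat_scale w) (\<lambda>x. u x 1) x"
proof -
  have s: "0 < heat_scale w" using w by (rule heat_scale_pos)
  have "fourier (dilate (heat_scale w) (\<lambda>x. u x 1)) \<xi> = fourier (\<lambda>x. u x w) \<xi>" for \<xi>
    using heat_scale_power[OF w] w by (simp add: fourier_dilate[OF s] u_fourier power_mult_distrib)
  then have "AE x in lborel. u x w = dilate (heat_scale w) (\<lambda>x. u x 1) x"
    by (intro fourier_injective u_integrable dilate_integrable s) simp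
  moreover have "continuous_on UNIV (dilate (heat_scale w) (\<lambda>x. u x 1))"
    unfolding dilate_def using s
    by (intro continuous_intros continuous_on_compose2[OF u_continuous[OF zero_less_one]]) auto
  ultimately have "(\<lambda>x. u x w) = dilate (heat_scale w) (\<lambda>x. u x 1)"
    by (intro continuous_AE_eq_imp_eq u_continuous w)
  then show ?thesis by (rule fun_cong)
qed

lemma u_measurable[measurable]: "(\<lambda>(x, w). u x w) \<in> borel_measurable (borel \<Otimes>\<^sub>M borel)"
proof -
  have [measurable]: "(\<lambda>x. u x 1) \<in> borel_measurable borel"
    using u_integrable by (rule integrable_borel)
  have "(\<lambda>(x, w). if 0 < w then u (x / heat_scale w) 1 / heat_scale w else 0) \<in> borel_measurable (borel \<Otimes>\<^sub>M borel)"
    by measurable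
  moreover have "(\<lambda>(x, w). if 0 < w then u (x / heat_scale w) 1 / heat_scale w else 0) = (\<lambda>(x, w). u x w)"
    using u_scaling[unfolded dilate_def] u_nonpos by (intro ext) (metis (no_types, lifting) case_prod_conv linorder_not_less surj_pair)
  ultimately show ?thesis by simp
qed

lemma L1_norm_u: "L1_norm (\<lambda>x. u x w) \<le> L1_norm (\<lambda>x. u x 1)"
proof (cases "0 < w")
  case True
  have "(\<lambda>x. u x w) = dilate (heat_scale w) (\<lambda>x. u x 1)"
    using True by (intro ext u_scaling)
  then show ?thesis using L1_norm_dilate[OF heat_scale_pos[OF True]] by simp
next
  case False
  then have "L1_norm (\<lambda>x. u x w) = 0" by (simp add: L1_norm_def u_nonpos)
  then show ?thesis by (simp add: L1_norm_nonneg)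
qed

lemma u_integral: "w > 0 \<Longrightarrow> (\<integral>x. u x w \<partial>lborel) = 1"
proof -
  assume "w > 0"
  then have "complex_of_real (\<integral>x. u x w \<partial>lborel) = 1"
    using u_fourier[of w 0] n_pos by (simp add: spectral_function_def)
  then show ?thesis by (simp only: of_real_eq_1_iff)
qed

section \<open>Time averages of the fundamental solution\<close>

text \<open>The kernel of the solution, the kernel of its covariance and the
  mean of the semigroup over a time interval all have this form.\<close>

definition mixture :: "(real \<Rightarrow> real) \<Rightarrow> real \<Rightarrow> real" where
  "mixture p x = (\<integral>w. p w * u x w \<partial>lborel)"

text \<open>The uniform bound on the $L^1$ norm of \<open>u\<close> in space makes Fubini's theorem available.\<close>

lemma mixture_pair_integrable:
  fixes c :: "real \<Rightarrow> 'a :: {banach, second_countable_topology}"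
  assumes p: "integrable lborel p" and c: "c \<in> borel_measurable borel" "\<And>x. norm (c x) \<le> B"
  shows "integrable (lborel \<Otimes>\<^sub>M lborel) (\<lambda>(x, w). (p w * u x w) *\<^sub>R c x)"
proof -
  note [measurable] = integrable_borel[OF p] c(1)
  have B: "0 \<le> B" using c(2)[of 0] norm_ge_zero order_trans by blast
  have int: "integrable lborel (\<lambda>x. u x w *\<^sub>R c x)" for w
    by (rule integrable_scaleR_bounded[OF u_integrable c])
  have "integrable (lborel \<Otimes>\<^sub>M lborel) (\<lambda>(w, x). (p w * u x w) *\<^sub>R c x)"
  proof (rule lborel_pair.Fubini_integrable)
    show "integrable lborel (\<lambda>w. \<integral>x. norm (case (w, x) of (w, x) \<Rightarrow> (p w * u x w) *\<^sub>R c x) \<partial>lborel)"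
    proof (rule Bochner_Integration.integrable_bound)
      show "integrable lborel (\<lambda>w. \<bar>p w\<bar> * (L1_norm (\<lambda>x. u x 1) * B))" using p by simp
      show "AE w in lborel. norm (\<integral>x. norm (case (w, x) of (w, x) \<Rightarrow> (p w * u x w) *\<^sub>R c x) \<partial>lborel)
          \<le> norm (\<bar>p w\<bar> * (L1_norm (\<lambda>x. u x 1) * B))"
      proof (rule AE_I2)
        fix w
        have "(\<integral>x. norm ((p w * u x w) *\<^sub>R c x) \<partial>lborel) = \<bar>p w\<bar> * (\<integral>x. norm (u x w *\<^sub>R c x) \<partial>lborel)"
          by (simp add: abs_mult mult.assoc)
        also have "(\<integral>x. norm (u x w *\<^sub>R c x) \<partial>lborel) \<le> (\<integral>x. \<bar>u x w\<bar> * B \<partial>lborel)"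
          using integrable_norm[OF int[of w]] u_integrable[of w] c(2)
          by (intro integral_mono) (auto intro!: mult_left_mono)
        also have "\<dots> = L1_norm (\<lambda>x. u x w) * B" by (simp add: L1_norm_def)
        also have "\<dots> \<le> L1_norm (\<lambda>x. u x 1) * B" using L1_norm_u B by (rule mult_right_mono)
        finally have "(\<integral>x. norm ((p w * u x w) *\<^sub>R c x) \<partial>lborel) \<le> \<bar>p w\<bar> * (L1_norm (\<lambda>x. u x 1) * B)"
          by (simp add: mult_left_mono)
        moreover have "0 \<le> (\<integral>x. norm ((p w * u x w) *\<^sub>R c x) \<partial>lborel)" by (rule integral_nonneg_AE) simp
        ultimately show "norm (\<integral>x. norm (case (w, x) of (w, x) \<Rightarrow> (p w * u x w) *\<^sub>R c x) \<partial>lborel)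
          \<le> norm (\<bar>p w\<bar> * (L1_norm (\<lambda>x. u x 1) * B))"
          unfolding prod.case real_norm_def by linarith
      qed
    qed measurable
    show "AE w in lborel. integrable lborel (\<lambda>x. case (w, x) of (w, x) \<Rightarrow> (p w * u x w) *\<^sub>R c x)"
      using int by (simp flip: scaleR_scaleR)
  qed measurable
  from lborel_pair.integrable_product_swap[OF this] show ?thesis by simp
qed

lemma mixture_AE_integrable:
  assumes "integrable lborel p"
  shows "AE x in lborel. integrable lborel (\<lambda>w. p w * u x w)"
  using lborel_pair.AE_integrable_fst'[OF mixture_pair_integrable[OF assms, of "\<lambda>_. 1::real" 1]] by simp

lemma mixture_integrable:
  assumes "integrable lborel p"
  shows "integrable lborel (mixture p)"
  using lborel_pair.integrable_fst'[OF mixture_pair_integrable[OF assms, of "\<lambda>_. 1::real" 1]]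
  by (simp add: mixture_def[abs_def])

lemma integral_mixture:
  fixes c :: "real \<Rightarrow> 'a :: {banach, second_countable_topology}"
  assumes p: "integrable lborel p" and c: "c \<in> borel_measurable borel" "\<And>x. norm (c x) \<le> B"
  shows "integrable lborel (\<lambda>w. p w *\<^sub>R (\<integral>x. u x w *\<^sub>R c x \<partial>lborel))"
    and "(\<integral>x. mixture p x *\<^sub>R c x \<partial>lborel) = (\<integral>w. p w *\<^sub>R (\<integral>x. u x w *\<^sub>R c x \<partial>lborel) \<partial>lborel)"
proof -
  note int = mixture_pair_integrable[OF p c]
  have inner: "(\<integral>x. (p w * u x w) *\<^sub>R c x \<partial>lborel) = p w *\<^sub>R (\<integral>x. u x w *\<^sub>R c x \<partial>lborel)" for w
    by (simp flip: scaleR_scaleR)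
  show "integrable lborel (\<lambda>w. p w *\<^sub>R (\<integral>x. u x w *\<^sub>R c x \<partial>lborel))"
    using lborel_pair.integrable_fst'[OF lborel_pair.integrable_product_swap[OF int]]
    by (simp add: inner)
  have "(\<integral>x. mixture p x *\<^sub>R c x \<partial>lborel) = (\<integral>x. (\<integral>w. (p w * u x w) *\<^sub>R c x \<partial>lborel) \<partial>lborel)"
  proof (rule integral_cong_AE)
    show "AE x in lborel. mixture p x *\<^sub>R c x = (\<integral>w. (p w * u x w) *\<^sub>R c x \<partial>lborel)"
      using mixture_AE_integrable[OF p] by eventually_elim (simp add: mixture_def)
    show "(\<lambda>x. mixture p x *\<^sub>R c x) \<in> borel_measurable lborel"
      using integrable_borel[OF mixture_integrable[OF p]] c(1) by simp
    show "(\<lambda>x. \<integral>w. (p w * u x w) *\<^sub>R c x \<partial>lborel) \<in> borel_measurable lborel"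
      using borel_measurable_integrable[OF lborel_pair.integrable_fst'[OF int]] by simp
  qed
  also have "\<dots> = (\<integral>w. (\<integral>x. (p w * u x w) *\<^sub>R c x \<partial>lborel) \<partial>lborel)"
    using lborel_pair.Fubini_integral[OF int] by simp
  finally show "(\<integral>x. mixture p x *\<^sub>R c x \<partial>lborel) = (\<integral>w. p w *\<^sub>R (\<integral>x. u x w *\<^sub>R c x \<partial>lborel) \<partial>lborel)"
    by (simp add: inner)
qed

lemma fourier_mixture:
  assumes p: "integrable lborel p" and neg: "\<And>w. w < 0 \<Longrightarrow> p w = 0"
  shows "fourier (mixture p) \<xi> = complex_of_real (\<integral>w. p w * exp (- (\<xi> ^ (2 * n)) * w) \<partial>lborel)"
proof -
  have "fourier (mixture p) \<xi> = (\<integral>w. p w *\<^sub>R fourier (\<lambda>x. u x w) \<xi> \<partial>lborel)"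
    unfolding fourier_scaleR by (rule integral_mixture(2)[OF p iexp_measurable, where B = 1]) simp
  also have "\<dots> = (\<integral>w. complex_of_real (p w * exp (- (\<xi> ^ (2 * n)) * w)) \<partial>lborel)"
  proof (rule integral_cong_AE)
    \<comment> \<open>At \<open>w = 0\<close> the function \<open>u\<close> is zero while the exponential is one.\<close>
    have "AE w in lborel. w \<noteq> (0::real)" by (rule AE_lborel_singleton)
    then show "AE w in lborel. p w *\<^sub>R fourier (\<lambda>x. u x w) \<xi> = complex_of_real (p w * exp (- (\<xi> ^ (2 * n)) * w))"
    proof eventually_elim
      case (elim w)
      then consider "0 < w" | "w < 0" by linarith
      then show ?case by cases (simp_all add: u_fourier neg scaleR_conv_of_real)
    qed
    show "(\<lambda>w. p w *\<^sub>R fourier (\<lambda>x. u x w) \<xi>) \<in> borel_measurable lborel"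
      unfolding fourier_scaleR
      by (rule borel_measurable_integrable[OF integral_mixture(1)[OF p iexp_measurable, where B = 1]]) simp
    show "(\<lambda>w. complex_of_real (p w * exp (- (\<xi> ^ (2 * n)) * w))) \<in> borel_measurable lborel"
      using integrable_borel[OF p] by simp
  qed
  finally show ?thesis by (simp only: integral_complex_of_real)
qed

lemma mixture_even: "mixture p (- x) = mixture p x"
  by (simp add: mixture_def u_even)

lemma L2_inner_mixture:
  assumes p: "integrable lborel p" and f: "f \<in> L2_space" and g: "g \<in> L2_space"
  shows "integrable lborel (\<lambda>w. p w * L2_inner (fun_convolution (\<lambda>x. u x w) f) g)"
    and "L2_inner (fun_convolution (mixture p) f) g =
      (\<integral>w. p w * L2_inner (fun_convolution (\<lambda>x. u x w) f) g \<partial>lborel)"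
  using integral_mixture[OF p correlation_measurable[OF L2_space_borel[OF f] L2_space_borel[OF g]],
      of "L2_norm f * L2_norm g"] correlation_bound[OF f g]
  by (simp_all add: L2_inner_fun_convolution u_integrable mixture_integrable p f g)

section \<open>The heat semigroup and its generator\<close>

text \<open>At time \<open>0\<close> the fundamental solution is the Dirac measure, which is not given by the function
  \<open>u\<close>.\<close>

definition heat_semigroup :: "real \<Rightarrow> (real \<Rightarrow> real) \<Rightarrow> real \<Rightarrow> real" where
  "heat_semigroup w f = (if w \<le> 0 then f else fun_convolution (\<lambda>x. u x w) f)"

lemma u_convolution:
  assumes v: "0 < v" and w: "0 < w"
  shows "AE x in lborel. u x (v + w) = fun_convolution (\<lambda>x. u x v) (\<lambda>x. u x w) x"
proof (intro fourier_injective u_integrable fun_convolution_integrable)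
  show "fourier (\<lambda>x. u x (v + w)) \<xi> = fourier (fun_convolution (\<lambda>x. u x v) (\<lambda>x. u x w)) \<xi>" for \<xi>
    using v w by (simp add: fourier_fun_convolution u_integrable u_fourier distrib_left exp_add exp_diff exp_minus field_simps)
qed

lemma heat_scale_tendsto: "filterlim heat_scale (at_right 0) (at_right 0)"
proof -
  have "((\<lambda>w. w powr (1 / real (2 * n))) \<longlongrightarrow> 0 powr (1 / real (2 * n))) (at_right 0)"
    using n_pos by (intro tendsto_powr') (auto simp: eventually_at_filter intro!: tendsto_intros)
  then have "(heat_scale \<longlongrightarrow> 0) (at_right 0)" by (simp add: heat_scale_def[abs_def])
  then show ?thesis
    by (rule filterlim_at_withinI) (auto simp: eventually_at_filter heat_scale_def)
qed

text \<open>Applies both to \<open>u\<close> itself and to its time means, since both are dilations of a fixed kernel.\<close>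

lemma dilated_kernel_tendsto:
  assumes k: "integrable lborel k" "(\<integral>x. k x \<partial>lborel) = 1" and f: "f \<in> L2_space"
    and l: "\<And>w. 0 < w \<Longrightarrow> l w = dilate (heat_scale w) k"
  shows "((\<lambda>w. L2_norm (\<lambda>x. fun_convolution (l w) f x - f x)) \<longlongrightarrow> 0) (at_right 0)"
proof -
  have "((\<lambda>w. L2_norm (\<lambda>x. fun_convolution (dilate (heat_scale w) k) f x - f x)) \<longlongrightarrow> 0) (at_right 0)"
    by (rule filterlim_compose[OF approximate_identity[OF k f] heat_scale_tendsto])
  moreover have "\<forall>\<^sub>F w in at_right 0. L2_norm (\<lambda>x. fun_convolution (dilate (heat_scale w) k) f x - f x)
      = L2_norm (\<lambda>x. fun_convolution (l w) f x - f x)"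
    unfolding eventually_at_filter by (intro always_eventually) (simp add: l)
  ultimately show ?thesis by (rule Lim_transform_eventually)
qed

lemma C0_heat_semigroup: "C0_semigroup heat_semigroup"
  unfolding C0_semigroup_def
proof (intro conjI allI impI ballI)
  fix w :: real
  have "bounded_L2_operator (\<lambda>f. f)"
    unfolding bounded_L2_operator_def by (auto intro: exI[of _ 1])
  then have "bounded_L2_operator (heat_semigroup w)" if "w \<le> 0"
    using that by (simp add: heat_semigroup_def[abs_def])
  moreover have "heat_semigroup w = fun_convolution (\<lambda>x. u x w)" if "\<not> w \<le> 0"
    using that by (simp add: heat_semigroup_def fun_eq_iff)
  ultimately show "bounded_L2_operator (heat_semigroup w)"
    using bounded_L2_operator_fun_convolution[OF u_integrable] by (cases "w \<le> 0") auto
next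
  fix f :: "real \<Rightarrow> real"
  show "AE x in lborel. heat_semigroup 0 f x = f x" by (simp add: heat_semigroup_def)
next
  fix v w :: real and f assume v: "0 \<le> v" and w: "0 \<le> w" and f: "f \<in> L2_space"
  show "AE x in lborel. heat_semigroup (v + w) f x = heat_semigroup v (heat_semigroup w f) x"
  proof (cases "v = 0 \<or> w = 0")
    case False
    with v w have v: "0 < v" and w: "0 < w" by auto
    have "fun_convolution (\<lambda>x. u x (v + w)) f = fun_convolution (fun_convolution (\<lambda>x. u x v) (\<lambda>x. u x w)) f"
      using f by (intro fun_convolution_cong_AE u_convolution v w L2_space_borel integrable_borel
          u_integrable fun_convolution_integrable)
    then show ?thesis
      using fun_convolution_assoc[OF u_integrable u_integrable f] v w by (simp add: heat_semigroup_def)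
  qed (auto simp: heat_semigroup_def)
next
  fix f assume f: "f \<in> L2_space"
  have "((\<lambda>w. L2_norm (\<lambda>x. fun_convolution (\<lambda>x. u x w) f x - f x)) \<longlongrightarrow> 0) (at_right 0)"
    by (intro dilated_kernel_tendsto[OF u_integrable u_integral[OF zero_less_one] f] ext u_scaling)
  moreover have "\<forall>\<^sub>F w in at_right 0. L2_norm (\<lambda>x. fun_convolution (\<lambda>x. u x w) f x - f x) =
      L2_norm (\<lambda>x. heat_semigroup w f x - f x)"
    unfolding eventually_at_filter by (intro always_eventually) (simp add: heat_semigroup_def)
  ultimately show "((\<lambda>w. L2_norm (\<lambda>x. heat_semigroup w f x - f x)) \<longlongrightarrow> 0) (at_right 0)"
    by (rule Lim_transform_eventually)
qed

text \<open>The kernel of $\frac1w \int_0^w e^{-vA} \, dv$, the operator that relates difference quotients of the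
  semigroup to its generator.\<close>

definition mean_kernel :: "real \<Rightarrow> real \<Rightarrow> real" where
  "mean_kernel w = mixture (\<lambda>v. indicator {0..w} v / w)"

lemma mean_weight_integrable: "integrable lborel (\<lambda>v. indicator {0..w} v / w :: real)"
  by (intro integrable_divide integrable_real_indicator) (auto simp: emeasure_lborel_Icc_eq)

lemma mean_kernel_integrable: "integrable lborel (mean_kernel w)"
  unfolding mean_kernel_def by (intro mixture_integrable mean_weight_integrable)

lemma mean_kernel_scaling:
  assumes w: "0 < w"
  shows "mean_kernel w = dilate (heat_scale w) (mean_kernel 1)"
proof
  fix x
  have u_scale: "u x (w * v) = u (x / heat_scale w) v / heat_scale w" for v
  proof (cases "0 < v")
    case True
    then show ?thesis
      using w u_scaling[of "w * v" x] u_scaling[of v "x / heat_scale w"] by (simp add: dilate_def heat_scale_def powr_mult)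
  next
    case False
    then show ?thesis using w by (simp add: u_nonpos mult_le_0_iff)
  qed
  have "mean_kernel w x = \<bar>w\<bar> *\<^sub>R (\<integral>v. indicator {0..w} (0 + w * v) / w * u x (0 + w * v) \<partial>lborel)"
    unfolding mean_kernel_def mixture_def using w by (intro lborel_integral_real_affine) simp
  also have "\<dots> = (\<integral>v. w * (indicator {0..w} (0 + w * v) / w * u x (0 + w * v)) \<partial>lborel)"
    using w by (simp only: abs_of_pos real_scaleR_def integral_mult_right_zero)
  also have "\<dots> = (\<integral>v. indicator {0..1} v / 1 * u (x / heat_scale w) v / heat_scale w \<partial>lborel)"
  proof -
    have "w * (indicator {0..w} (0 + w * v) / w * u x (0 + w * v)) =
        indicator {0..1} v / 1 * u (x / heat_scale w) v / heat_scale w" for v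
      using w unfolding u_scale[symmetric] add_0
      by (auto simp: u_scale zero_le_mult_iff mult_le_cancel_left1 split: split_indicator)
    then show ?thesis by (simp only:)
  qed
  also have "\<dots> = dilate (heat_scale w) (mean_kernel 1) x"
    by (simp add: dilate_def mean_kernel_def mixture_def)
  finally show "mean_kernel w x = dilate (heat_scale w) (mean_kernel 1) x" .
qed

text \<open>The transform of the identity $w A \cdot \frac1w \int_0^w e^{-vA} \, dv = 1 - e^{-wA}$.\<close>

lemma fourier_mean_kernel:
  assumes w: "0 < w"
  shows "complex_of_real (w * \<xi> ^ (2 * n)) * fourier (mean_kernel w) \<xi> =
    1 - complex_of_real (exp (- (\<xi> ^ (2 * n)) * w))"
proof -
  define a where "a = \<xi> ^ (2 * n)"
  have "(\<integral>v. indicator {0..w} v *\<^sub>R (a * exp (- a * v)) \<partial>lborel) = - exp (- a * w) - (- exp (- a * 0))"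
  proof (rule integral_FTC_atLeastAtMost)
    show "((\<lambda>v. - exp (- a * v)) has_vector_derivative a * exp (- a * v)) (at v within {0..w})" for v
      unfolding has_real_derivative_iff_has_vector_derivative[symmetric]
      by (auto intro!: derivative_eq_intros)
  qed (use w in \<open>auto intro!: continuous_intros\<close>)
  then have 1: "(\<integral>v. indicator {0..w} v *\<^sub>R (a * exp (- a * v)) \<partial>lborel) = 1 - exp (- a * w)" by simp
  have "w * a * (\<integral>v. indicator {0..w} v / w * exp (- a * v) \<partial>lborel) =
      (\<integral>v. w * a * (indicator {0..w} v / w * exp (- a * v)) \<partial>lborel)" by simp
  also have "\<dots> = 1 - exp (- a * w)"
    unfolding 1[symmetric] using w by (intro Bochner_Integration.integral_cong) auto
  finally have "complex_of_real (w * a) * complex_of_real (\<integral>v. indicator {0..w} v / w * exp (- a * v) \<partial>lborel) =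
      1 - complex_of_real (exp (- a * w))"
    by (simp only: of_real_mult[symmetric] of_real_diff of_real_1)
  moreover have "fourier (mean_kernel w) \<xi> =
      complex_of_real (\<integral>v. indicator {0..w} v / w * exp (- (\<xi> ^ (2 * n)) * v) \<partial>lborel)"
    unfolding mean_kernel_def by (rule fourier_mixture[OF mean_weight_integrable]) simp
  ultimately show ?thesis by (simp only: a_def)
qed

lemma mean_kernel_integral: "(\<integral>x. mean_kernel 1 x \<partial>lborel) = 1"
proof -
  have "complex_of_real (\<integral>x. mean_kernel 1 x \<partial>lborel) = fourier (mean_kernel 1) 0"
    by (simp add: spectral_function_def)
  also have "\<dots> = 1"
  proof -
    have "(0::real) ^ (2 * n) = 0" using n_pos by simp
    then show ?thesis
      using fourier_mixture[OF mean_weight_integrable[of 1], of 0] by (simp only: mean_kernel_def) simp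
  qed
  finally show ?thesis by (simp only: of_real_eq_1_iff)
qed

lemma mean_kernel_tendsto:
  assumes "f \<in> L2_space"
  shows "((\<lambda>w. L2_norm (\<lambda>x. fun_convolution (mean_kernel w) f x - f x)) \<longlongrightarrow> 0) (at_right 0)"
  by (rule dilated_kernel_tendsto[OF mean_kernel_integrable mean_kernel_integral assms mean_kernel_scaling])

text \<open>The operator $A$ on test functions, where derivatives are classical.\<close>

abbreviation elliptic_operator :: "(real \<Rightarrow> real) \<Rightarrow> real \<Rightarrow> real" where
  "elliptic_operator \<psi> \<equiv> (\<lambda>x. (- 1) ^ n * (deriv ^^ (2 * n)) \<psi> x)"

lemma elliptic_operator_L2: "test_function \<psi> \<Longrightarrow> elliptic_operator \<psi> \<in> L2_space"
  by (intro L2_scale test_function_L2 test_function_higher_deriv)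

text \<open>Test functions, their derivatives and the kernels are all integrable, so $e^{-wA} \psi - \psi =
  - \int_0^w e^{-vA} A \psi \, dv$ can be checked on Fourier transforms.\<close>

lemma heat_difference_test_function:
  assumes \<psi>: "test_function \<psi>" and w: "0 < w"
  shows "AE x in lborel. fun_convolution (\<lambda>x. u x w) \<psi> x - \<psi> x =
    (- w) * fun_convolution (mean_kernel w) (elliptic_operator \<psi>) x"
proof (rule fourier_injective)
  have i\<psi>: "integrable lborel \<psi>" using \<psi> by (rule test_function_integrable)
  have iA: "integrable lborel (elliptic_operator \<psi>)"
    by (intro integrable_mult_right test_function_integrable test_function_higher_deriv \<psi>)
  have iu: "integrable lborel (fun_convolution (\<lambda>x. u x w) \<psi>)"
    by (intro fun_convolution_integrable u_integrable i\<psi>)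
  show "integrable lborel (\<lambda>x. fun_convolution (\<lambda>x. u x w) \<psi> x - \<psi> x)"
    using iu i\<psi> by simp
  show "integrable lborel (\<lambda>x. (- w) * fun_convolution (mean_kernel w) (elliptic_operator \<psi>) x)"
    by (intro integrable_mult_right fun_convolution_integrable mean_kernel_integrable iA)
  fix \<xi>
  have "fourier (elliptic_operator \<psi>) \<xi> = (- 1) ^ n * (- \<i> * \<xi>) ^ (2 * n) * fourier \<psi> \<xi>"
    by (simp only: fourier_cmult fourier_higher_deriv[OF \<psi>]) simp
  also have "(- 1) ^ n * (- \<i> * complex_of_real \<xi>) ^ (2 * n) = complex_of_real (\<xi> ^ (2 * n))"
    by (simp add: power_mult power_mult_distrib flip: power_mult_distrib[of "-1" _ n])
  finally have A: "fourier (elliptic_operator \<psi>) \<xi> = complex_of_real (\<xi> ^ (2 * n)) * fourier \<psi> \<xi>" .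
  have "fourier (\<lambda>x. fun_convolution (\<lambda>x. u x w) \<psi> x - \<psi> x) \<xi> =
      - (1 - complex_of_real (exp (- (\<xi> ^ (2 * n)) * w))) * fourier \<psi> \<xi>"
    by (simp add: fourier_diff[OF iu i\<psi>] fourier_fun_convolution[OF u_integrable i\<psi>] u_fourier[OF w]
        algebra_simps)
  also have "\<dots> = - (complex_of_real (w * \<xi> ^ (2 * n)) * fourier (mean_kernel w) \<xi>) * fourier \<psi> \<xi>"
    unfolding fourier_mean_kernel[OF w] by simp
  also have "\<dots> = fourier (\<lambda>x. (- w) * fun_convolution (mean_kernel w) (elliptic_operator \<psi>) x) \<xi>"
    unfolding fourier_cmult[of "- w"] fourier_fun_convolution[OF mean_kernel_integrable iA] A
    by simp
  finally show "fourier (\<lambda>x. fun_convolution (\<lambda>x. u x w) \<psi> x - \<psi> x) \<xi> =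
      fourier (\<lambda>x. (- w) * fun_convolution (mean_kernel w) (elliptic_operator \<psi>) x) \<xi>" .
qed

text \<open>The semigroup is symmetric, so the difference quotient may be moved to the test function.\<close>

lemma difference_quotient_test:
  assumes f: "f \<in> L2_space" and \<psi>: "test_function \<psi>" and w: "0 < w"
  shows "L2_inner (\<lambda>x. (heat_semigroup w f x - f x) / w) \<psi> =
    - L2_inner f (fun_convolution (mean_kernel w) (elliptic_operator \<psi>))"
proof -
  have \<psi>2: "\<psi> \<in> L2_space" using \<psi> by (rule test_function_L2)
  let ?U = "fun_convolution (\<lambda>x. u x w)"
  have Uf: "?U f \<in> L2_space" and U\<psi>: "?U \<psi> \<in> L2_space"
    by (intro fun_convolution_L2 u_integrable f \<psi>2)+
  have MA: "fun_convolution (mean_kernel w) (elliptic_operator \<psi>) \<in> L2_space"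
    by (intro fun_convolution_L2 mean_kernel_integrable elliptic_operator_L2 \<psi>)
  have "L2_inner (\<lambda>x. (heat_semigroup w f x - f x) / w) \<psi> = L2_inner (\<lambda>x. (1 / w) * (?U f x - f x)) \<psi>"
    using w by (simp add: heat_semigroup_def)
  also have "\<dots> = 1 / w * (L2_inner (?U f) \<psi> - L2_inner f \<psi>)"
    by (simp only: L2_inner_scale_left L2_inner_diff_left[OF Uf f \<psi>2])
  also have "L2_inner (?U f) \<psi> - L2_inner f \<psi> = L2_inner (\<lambda>x. ?U \<psi> x - \<psi> x) f"
    by (simp add: L2_inner_fun_convolution_symmetric[OF u_integrable u_even f \<psi>2]
        L2_inner_diff_left[OF U\<psi> \<psi>2 f] L2_inner_commute[of f])
  also have "\<dots> = L2_inner (\<lambda>x. (- w) * fun_convolution (mean_kernel w) (elliptic_operator \<psi>) x) f"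
    by (intro L2_inner_cong_AE L2_diff heat_difference_test_function U\<psi> \<psi>2 \<psi> f w
        L2_space_borel[OF L2_scale] MA)
  also have "\<dots> = - w * L2_inner f (fun_convolution (mean_kernel w) (elliptic_operator \<psi>))"
    by (simp only: L2_inner_scale_left L2_inner_commute[of f])
  finally show ?thesis using w by simp
qed

lemma heat_semigroup_L2: "f \<in> L2_space \<Longrightarrow> heat_semigroup w f \<in> L2_space"
  by (simp add: heat_semigroup_def fun_convolution_L2 u_integrable)

text \<open>Both sides of \<open>difference_quotient_test\<close> converge as \<open>w\<close> tends to zero: the left one by
  assumption, the right one because the time means form an approximate identity.\<close>

lemma generator_imp_heat_operator:
  assumes "semigroup_generator heat_semigroup f g"
  shows "heat_operator n f (\<lambda>x. - g x)"
proof -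
  have f: "f \<in> L2_space" and g: "g \<in> L2_space"
    and lim: "((\<lambda>w. L2_norm (\<lambda>x. (heat_semigroup w f x - f x) / w - g x)) \<longlongrightarrow> 0) (at_right 0)"
    using assms by (auto simp: semigroup_generator_def)
  have "L2_inner (\<lambda>x. - g x) \<psi> = (- 1) ^ n * L2_inner f ((deriv ^^ (2 * n)) \<psi>)" if \<psi>: "test_function \<psi>" for \<psi>
  proof -
    have A: "elliptic_operator \<psi> \<in> L2_space" using \<psi> by (rule elliptic_operator_L2)
    have quot: "(\<lambda>x. (heat_semigroup w f x - f x) / w) \<in> L2_space" for w
      using L2_scale[OF L2_diff[OF heat_semigroup_L2[OF f] f], of "1 / w" w] by simp
    have "((\<lambda>w. L2_inner (\<lambda>x. (heat_semigroup w f x - f x) / w) \<psi>) \<longlongrightarrow> L2_inner g \<psi>) (at_right 0)"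
      by (intro L2_inner_tendsto quot g test_function_L2 \<psi> lim)
    moreover have "\<forall>\<^sub>F w in at_right 0. L2_inner (\<lambda>x. (heat_semigroup w f x - f x) / w) \<psi> =
        - L2_inner (fun_convolution (mean_kernel w) (elliptic_operator \<psi>)) f"
      unfolding eventually_at_filter
      by (intro always_eventually) (simp add: difference_quotient_test[OF f \<psi>] L2_inner_commute[of f])
    ultimately have "((\<lambda>w. - L2_inner (fun_convolution (mean_kernel w) (elliptic_operator \<psi>)) f) \<longlongrightarrow> L2_inner g \<psi>) (at_right 0)"
      by (rule Lim_transform_eventually)
    moreover have "((\<lambda>w. - L2_inner (fun_convolution (mean_kernel w) (elliptic_operator \<psi>)) f) \<longlongrightarrow>
        - L2_inner (elliptic_operator \<psi>) f) (at_right 0)"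
      by (intro tendsto_minus L2_inner_tendsto fun_convolution_L2 mean_kernel_integrable A f mean_kernel_tendsto)
    ultimately have "L2_inner g \<psi> = - L2_inner (elliptic_operator \<psi>) f"
      by (rule tendsto_unique[OF trivial_limit_at_right_real])
    then show ?thesis
      by (simp add: L2_inner_minus_left L2_inner_scale_left L2_inner_commute[of f])
  qed
  with f L2_minus[OF g] show ?thesis by (simp add: heat_operator_def)
qed

text \<open>The point is that the difference quotient of \<open>f\<close> equals the time mean of \<open>g\<close>. Both have the
  same pairing with every test function, because the weak derivative commutes with the time mean; and test
  functions separate the elements of $L^2$. The time means of \<open>g\<close> converge to \<open>g\<close>.\<close>

lemma heat_operator_imp_generator:
  assumes "heat_operator n f (\<lambda>x. - g x)"
  shows "semigroup_generator heat_semigroup f g"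
proof -
  have f: "f \<in> L2_space" and g': "(\<lambda>x. - g x) \<in> L2_space"
    and weak: "\<And>\<psi>. test_function \<psi> \<Longrightarrow> L2_inner (\<lambda>x. - g x) \<psi> = (- 1) ^ n * L2_inner f ((deriv ^^ (2 * n)) \<psi>)"
    using assms by (auto simp: heat_operator_def)
  have g: "g \<in> L2_space" using L2_minus[OF g'] by simp
  have mean: "AE x in lborel. (heat_semigroup w f x - f x) / w = fun_convolution (mean_kernel w) g x" if w: "0 < w" for w
  proof -
    let ?M = "fun_convolution (mean_kernel w)"
    have Mg: "?M g \<in> L2_space" and Mf: "?M f \<in> L2_space"
      by (intro fun_convolution_L2 mean_kernel_integrable f g)+
    have quot: "(\<lambda>x. (heat_semigroup w f x - f x) / w) \<in> L2_space"
      using L2_scale[OF L2_diff[OF heat_semigroup_L2[OF f] f], of "1 / w" w] by simp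
    have "AE x in lborel. (heat_semigroup w f x - f x) / w - ?M g x = 0"
    proof (rule L2_eq_0_of_test_functions)
      show "(\<lambda>x. (heat_semigroup w f x - f x) / w - ?M g x) \<in> L2_space"
        using quot Mg by (rule L2_diff)
      fix \<psi> assume \<psi>: "test_function \<psi>"
      have "L2_inner f (?M (elliptic_operator \<psi>)) = L2_inner (?M f) (elliptic_operator \<psi>)"
        unfolding mean_kernel_def
        by (intro L2_inner_fun_convolution_symmetric[symmetric] mixture_integrable mean_weight_integrable
            mixture_even f elliptic_operator_L2 \<psi>)
      also have "\<dots> = (- 1) ^ n * L2_inner (?M f) ((deriv ^^ (2 * n)) \<psi>)"
        by (simp only: L2_inner_commute[of "?M f"] L2_inner_scale_left)
      also have "\<dots> = L2_inner (?M (\<lambda>x. - g x)) \<psi>"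
        by (rule weak_derivative_fun_convolution[OF mean_kernel_integrable f g' weak \<psi>, symmetric])
      also have "?M (\<lambda>x. - g x) = (\<lambda>x. - ?M g x)" by (simp add: fun_convolution_def fun_eq_iff)
      finally have "L2_inner f (?M (elliptic_operator \<psi>)) = - L2_inner (?M g) \<psi>"
        by (simp only: L2_inner_minus_left)
      then show "L2_inner (\<lambda>x. (heat_semigroup w f x - f x) / w - ?M g x) \<psi> = 0"
        using L2_inner_diff_left[OF quot Mg test_function_L2[OF \<psi>]] difference_quotient_test[OF f \<psi> w] by simp
    qed
    then show ?thesis by simp
  qed
  have "((\<lambda>w. L2_norm (\<lambda>x. fun_convolution (mean_kernel w) g x - g x)) \<longlongrightarrow> 0) (at_right 0)"
    using g by (rule mean_kernel_tendsto)
  moreover have "\<forall>\<^sub>F w in at_right 0. L2_norm (\<lambda>x. fun_convolution (mean_kernel w) g x - g x) =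
      L2_norm (\<lambda>x. (heat_semigroup w f x - f x) / w - g x)"
    unfolding eventually_at_filter
  proof (intro always_eventually allI impI)
    fix w :: real assume "w \<in> {0<..}"
    then have w: "0 < w" by simp
    note [measurable] = L2_space_borel[OF f] L2_space_borel[OF g] L2_space_borel[OF heat_semigroup_L2[OF f]]
      L2_space_borel[OF fun_convolution_L2(1)[OF mean_kernel_integrable g]]
    show "L2_norm (\<lambda>x. fun_convolution (mean_kernel w) g x - g x) =
      L2_norm (\<lambda>x. (heat_semigroup w f x - f x) / w - g x)"
      using mean[OF w] by (intro L2_norm_cong_AE) (measurable, auto elim: eventually_mono)
  qed
  ultimately have "((\<lambda>w. L2_norm (\<lambda>x. (heat_semigroup w f x - f x) / w - g x)) \<longlongrightarrow> 0) (at_right 0)"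
    by (rule Lim_transform_eventually)
  with f g show ?thesis by (simp add: semigroup_generator_def)
qed

lemma heat_semigroup_generated: "generated_by_minus_heat_operator n heat_semigroup"
  unfolding generated_by_minus_heat_operator_def
  using C0_heat_semigroup generator_imp_heat_operator heat_operator_imp_generator by blast

end

section \<open>Negative fractional powers\<close>

text \<open>The weight in the definition of $(r + A)^{-a}$. The gamma density with shape \<open>a\<close> and rate
  \<open>r\<close> is $r^a$ times this weight.\<close>

definition gamma_weight :: "real \<Rightarrow> real \<Rightarrow> real \<Rightarrow> real" where
  "gamma_weight a r w = indicator {0<..} w * (w powr (a - 1) * exp (- r * w)) / Gamma a"

lemma has_integral_gamma_weight:
  assumes a: "0 < a" and r: "0 < r"
  shows "has_bochner_integral lborel (gamma_weight a r) (r powr (- a))"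
proof -
  have "has_bochner_integral lborel (\<lambda>t. indicator {0..} t * t powr (a - 1) / exp t) (Gamma a)"
    using Gamma_conv_nn_integral_real[OF a] Gamma_real_pos[OF a]
    by (intro has_bochner_integral_nn_integral) (auto split: split_indicator)
  then have "has_bochner_integral lborel
      (\<lambda>w. indicator {0..} (0 + r * w) * (0 + r * w) powr (a - 1) / exp (0 + r * w)) (Gamma a /\<^sub>R \<bar>r\<bar>)"
    using r lborel_has_bochner_integral_real_affine_iff[of r _ "Gamma a" 0] by simp
  then have "has_bochner_integral lborel
      (\<lambda>w. r powr (1 - a) / Gamma a * (indicator {0..} (0 + r * w) * (0 + r * w) powr (a - 1) / exp (0 + r * w)))
      (r powr (1 - a) / Gamma a * (Gamma a /\<^sub>R \<bar>r\<bar>))"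
    by (rule has_bochner_integral_mult_right)
  moreover have "r powr (1 - a) / Gamma a * (Gamma a /\<^sub>R \<bar>r\<bar>) = r powr (- a)"
    using Gamma_real_pos[OF a] r by (simp add: powr_diff powr_minus field_simps)
  moreover have "r powr (1 - a) / Gamma a * (indicator {0..} (0 + r * w) * (0 + r * w) powr (a - 1) / exp (0 + r * w))
      = gamma_weight a r w" for w
  proof (cases "0 < w")
    case True
    then show ?thesis using r
      by (simp add: gamma_weight_def powr_mult exp_minus powr_diff field_simps)
  next
    case False
    then show ?thesis using r
      by (cases "w = 0") (auto simp: gamma_weight_def zero_le_mult_iff split: split_indicator)
  qed
  ultimately show ?thesis by simp
qed

lemma gamma_weight_integrable: "0 < a \<Longrightarrow> 0 < r \<Longrightarrow> integrable lborel (gamma_weight a r)"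
  using has_integral_gamma_weight by (rule integrable.intros)

text \<open>Multiplying by an exponential only shifts the rate, so the Laplace transform of the weight is its total
  mass at another rate.\<close>

lemma gamma_weight_mult_exp: "gamma_weight a r w * exp (- s * w) = gamma_weight a (r + s) w"
  by (simp add: gamma_weight_def algebra_simps flip: exp_add)

context heat_kernel
begin

lemma fourier_gamma_mixture:
  assumes "0 < a" "0 < r"
  shows "fourier (mixture (gamma_weight a r)) \<xi> = complex_of_real ((r + \<xi> ^ (2 * n)) powr (- a))"
proof -
  have "0 \<le> \<xi> ^ (2 * n)" by simp
  then have r: "0 < r + \<xi> ^ (2 * n)" using assms(2) by linarith
  have "fourier (mixture (gamma_weight a r)) \<xi> =
      complex_of_real (\<integral>w. gamma_weight a r w * exp (- (\<xi> ^ (2 * n)) * w) \<partial>lborel)"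
    by (rule fourier_mixture[OF gamma_weight_integrable[OF assms]]) (simp add: gamma_weight_def)
  also have "\<dots> = complex_of_real ((r + \<xi> ^ (2 * n)) powr (- a))"
    unfolding gamma_weight_mult_exp
    by (simp only: has_bochner_integral_integral_eq[OF has_integral_gamma_weight[OF assms(1) r]])
  finally show ?thesis .
qed

text \<open>The kernel form of $(r + A)^{-a} (r + A)^{-b} = (r + A)^{-(a + b)}$. For \<open>a = b\<close> it identifies the
  covariance kernel.\<close>

lemma gamma_mixture_convolution:
  assumes a: "0 < a" and b: "0 < b" and r: "0 < r"
  shows "AE x in lborel. fun_convolution (mixture (gamma_weight a r)) (mixture (gamma_weight b r)) x =
    mixture (gamma_weight (a + b) r) x"
proof (rule fourier_injective)
  have i: "integrable lborel (mixture (gamma_weight c r))" if "0 < c" for c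
    using that r by (intro mixture_integrable gamma_weight_integrable)
  show "integrable lborel (fun_convolution (mixture (gamma_weight a r)) (mixture (gamma_weight b r)))"
    by (intro fun_convolution_integrable i a b)
  show "integrable lborel (mixture (gamma_weight (a + b) r))" using a b by (intro i) simp
  show "fourier (fun_convolution (mixture (gamma_weight a r)) (mixture (gamma_weight b r))) \<xi> =
      fourier (mixture (gamma_weight (a + b) r)) \<xi>" for \<xi>
    using a b r by (simp add: fourier_fun_convolution i fourier_gamma_mixture flip: of_real_mult powr_add)
qed

lemma negative_fractional_power_heat_semigroup:
  assumes \<beta>: "0 < \<beta>" and \<mu>: "0 < \<mu>"
  shows "negative_fractional_power heat_semigroup \<mu> \<beta> (fun_convolution (mixture (gamma_weight \<beta> \<mu>)))"
  unfolding negative_fractional_power_def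
proof (intro conjI ballI)
  note i = gamma_weight_integrable[OF \<beta> \<mu>]
  show "bounded_L2_operator (fun_convolution (mixture (gamma_weight \<beta> \<mu>)))"
    by (intro bounded_L2_operator_fun_convolution mixture_integrable i)
  fix f g assume f: "f \<in> L2_space" and g: "g \<in> L2_space"
  have eq: "indicator {0<..} w *\<^sub>R (w powr (\<beta> - 1) * exp (- \<mu> * w) * L2_inner (heat_semigroup w f) g) =
      Gamma \<beta> * (gamma_weight \<beta> \<mu> w * L2_inner (fun_convolution (\<lambda>x. u x w) f) g)" for w
    using Gamma_real_pos[OF \<beta>] by (auto simp: gamma_weight_def heat_semigroup_def split: split_indicator)
  show "set_integrable lborel {0<..} (\<lambda>w. w powr (\<beta> - 1) * exp (- \<mu> * w) * L2_inner (heat_semigroup w f) g)"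
    unfolding set_integrable_def eq by (intro integrable_mult_right L2_inner_mixture i f g)
  show "L2_inner (fun_convolution (mixture (gamma_weight \<beta> \<mu>)) f) g = 1 / Gamma \<beta> *
      (LINT w:{0<..}|lborel. w powr (\<beta> - 1) * exp (- \<mu> * w) * L2_inner (heat_semigroup w f) g)"
    unfolding set_lebesgue_integral_def eq L2_inner_mixture(2)[OF i f g]
    using Gamma_real_pos[OF \<beta>] by simp
qed

end

section \<open>White noise and covariance functions\<close>

lemma centered_gaussian_moments:
  assumes M: "prob_space M" and Y: "centered_gaussian M Y"
  shows "integrable M Y" and "prob_space.expectation M Y = 0" and "integrable M (\<lambda>\<omega>. (Y \<omega>)\<^sup>2)"
proof -
  have [measurable]: "Y \<in> borel_measurable M" using Y by (simp add: centered_gaussian_def)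
  consider "AE \<omega> in M. Y \<omega> = 0" | s where "s > 0" "distributed M lborel Y (normal_density 0 s)"
    using Y by (auto simp: centered_gaussian_def)
  then have "integrable M Y \<and> prob_space.expectation M Y = 0 \<and> integrable M (\<lambda>\<omega>. (Y \<omega>)\<^sup>2)"
  proof cases
    case 1
    have "integrable M Y \<longleftrightarrow> integrable M (\<lambda>_. 0::real)" "(\<integral>\<omega>. Y \<omega> \<partial>M) = (\<integral>\<omega>. 0 \<partial>M)"
      "integrable M (\<lambda>\<omega>. (Y \<omega>)\<^sup>2) \<longleftrightarrow> integrable M (\<lambda>_. 0::real)"
      by (intro integrable_cong_AE integral_cong_AE; use 1 in auto)+
    then show ?thesis by simp
  next
    case (2 s)
    then have D: "distributed M lborel Y (\<lambda>x. ennreal (normal_density 0 s x))" by simp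
    have "integrable lborel (\<lambda>x. normal_density 0 s x * x)"
      using integrable_normal_moment[OF 2(1), of 0 1] by simp
    moreover have "integrable lborel (\<lambda>x. normal_density 0 s x * x\<^sup>2)"
      using integrable_normal_moment[OF 2(1), of 0 2] by simp
    moreover have "(\<integral>x. normal_density 0 s x * x \<partial>lborel) = 0"
      using integral_normal_moment_nz_1[OF 2(1), of 0] by simp
    ultimately show ?thesis
      using distributed_integrable[OF D, of "\<lambda>x. x"] distributed_integrable[OF D, of "\<lambda>x. x\<^sup>2"]
        distributed_integral[OF D, of "\<lambda>x. x"] by simp
  qed
  then show "integrable M Y" "prob_space.expectation M Y = 0" "integrable M (\<lambda>\<omega>. (Y \<omega>)\<^sup>2)" by auto
qed

lemma integrable_mult_of_squares:
  fixes Y Z :: "'a \<Rightarrow> real"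
  assumes [measurable]: "Y \<in> borel_measurable M" "Z \<in> borel_measurable M"
    and "integrable M (\<lambda>\<omega>. (Y \<omega>)\<^sup>2)" "integrable M (\<lambda>\<omega>. (Z \<omega>)\<^sup>2)"
  shows "integrable M (\<lambda>\<omega>. Y \<omega> * Z \<omega>)"
proof (rule Bochner_Integration.integrable_bound)
  show "integrable M (\<lambda>\<omega>. (Y \<omega>)\<^sup>2 + (Z \<omega>)\<^sup>2)" using assms by simp
  show "AE \<omega> in M. norm (Y \<omega> * Z \<omega>) \<le> norm ((Y \<omega>)\<^sup>2 + (Z \<omega>)\<^sup>2)"
    using abs_mult_le_squares by (simp add: abs_le_iff)
qed measurable

lemma covariance_pairing:
  "(\<integral>t. (\<integral>s. C (t - s) * \<phi> t * \<psi> s \<partial>lborel) \<partial>lborel) = L2_inner \<phi> (fun_convolution C \<psi>)"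
proof -
  have "(\<integral>s. C (t - s) * \<phi> t * \<psi> s \<partial>lborel) = \<phi> t * fun_convolution C \<psi> t" for t
  proof -
    have "(\<integral>s. C (t - s) * \<phi> t * \<psi> s \<partial>lborel) = (\<integral>s. \<phi> t * (C (t - s) * \<psi> (t - (t - s))) \<partial>lborel)"
      by (intro Bochner_Integration.integral_cong) (auto simp: mult_ac)
    also have "\<dots> = (\<integral>x. \<phi> t * (C x * \<psi> (t - x)) \<partial>lborel)"
      by (rule lborel_integral_reflect)
    finally show ?thesis by (simp add: fun_convolution_def)
  qed
  then show ?thesis by (simp add: L2_inner_def)
qed

text \<open>The covariance of the noise at \<open>K * \<phi>\<close> and \<open>K * \<psi>\<close> is \<open>\<sigma>\<^sup>2\<close> times
  their inner product; by symmetry and associativity both convolutions can be collected on one side.\<close>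

lemma covariance_function_kernel_process:
  assumes noise: "white_noise M \<sigma> \<E>" and K: "integrable lborel K" "\<And>x. K (- x) = K x"
  shows "covariance_function M (kernel_process \<E> K) (\<lambda>h. \<sigma>\<^sup>2 * fun_convolution K K h)"
  unfolding covariance_function_def
proof (intro conjI ballI)
  have M: "prob_space M"
    and gauss: "\<And>\<phi>. \<phi> \<in> L2_space \<Longrightarrow> centered_gaussian M (\<E> \<phi>)"
    and cov: "\<And>\<phi> \<psi>. \<phi> \<in> L2_space \<Longrightarrow> \<psi> \<in> L2_space \<Longrightarrow>
      prob_space.expectation M (\<lambda>\<omega>. \<E> \<phi> \<omega> * \<E> \<psi> \<omega>) = \<sigma>\<^sup>2 * L2_inner \<phi> \<psi>"
    using noise by (auto simp: white_noise_def)
  have KK: "integrable lborel (fun_convolution K K)" by (intro fun_convolution_integrable K)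
  then show "integrable lborel (\<lambda>h. \<sigma>\<^sup>2 * fun_convolution K K h)" by simp
  fix \<phi> assume \<phi>: "\<phi> \<in> L2_space"
  have K\<phi>: "fun_convolution K \<phi> \<in> L2_space" by (intro fun_convolution_L2 K \<phi>)
  note G\<phi> = centered_gaussian_moments[OF M gauss[OF K\<phi>]]
  show "integrable M (kernel_process \<E> K \<phi>)" "prob_space.expectation M (kernel_process \<E> K \<phi>) = 0"
    using G\<phi> by (simp_all add: kernel_process_def)
  fix \<psi> assume \<psi>: "\<psi> \<in> L2_space"
  have K\<psi>: "fun_convolution K \<psi> \<in> L2_space" by (intro fun_convolution_L2 K \<psi>)
  note G\<psi> = centered_gaussian_moments[OF M gauss[OF K\<psi>]]
  show "integrable M (\<lambda>\<omega>. kernel_process \<E> K \<phi> \<omega> * kernel_process \<E> K \<psi> \<omega>)"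
    unfolding kernel_process_def
    using gauss[OF K\<phi>] gauss[OF K\<psi>] G\<phi> G\<psi>
    by (intro integrable_mult_of_squares) (auto simp: centered_gaussian_def)
  have "prob_space.expectation M (\<lambda>\<omega>. kernel_process \<E> K \<phi> \<omega> * kernel_process \<E> K \<psi> \<omega>) =
      \<sigma>\<^sup>2 * L2_inner (fun_convolution K \<phi>) (fun_convolution K \<psi>)"
    unfolding kernel_process_def by (rule cov[OF K\<phi> K\<psi>])
  also have "L2_inner (fun_convolution K \<phi>) (fun_convolution K \<psi>) =
      L2_inner (fun_convolution K (fun_convolution K \<psi>)) \<phi>"
    using L2_inner_fun_convolution_symmetric[OF K \<phi> K\<psi>] by (simp add: L2_inner_commute[of \<phi>])
  also have "\<dots> = L2_inner (fun_convolution (fun_convolution K K) \<psi>) \<phi>"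
    by (intro L2_inner_cong_AE[symmetric] fun_convolution_assoc fun_convolution_L2 KK K \<phi> \<psi> L2_space_borel)
  also have "\<sigma>\<^sup>2 * \<dots> = L2_inner \<phi> (fun_convolution (\<lambda>h. \<sigma>\<^sup>2 * fun_convolution K K h) \<psi>)"
    by (simp only: fun_convolution_cmult_left L2_inner_scale_left L2_inner_commute[of \<phi>])
  finally show "prob_space.expectation M (\<lambda>\<omega>. kernel_process \<E> K \<phi> \<omega> * kernel_process \<E> K \<psi> \<omega>) =
      (\<integral>t. (\<integral>s. \<sigma>\<^sup>2 * fun_convolution K K (t - s) * \<phi> t * \<psi> s \<partial>lborel) \<partial>lborel)"
    by (simp only: covariance_pairing[of "\<lambda>h. \<sigma>\<^sup>2 * fun_convolution K K h"])
qed

lemma std_normal_density_L2: "std_normal_density \<in> L2_space"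
proof -
  have "integrable lborel (\<lambda>x. (std_normal_density x)\<^sup>2)"
  proof (rule Bochner_Integration.integrable_bound)
    show "integrable lborel std_normal_density" by simp
    have "std_normal_density x \<le> 1" for x
    proof -
      have "1 \<le> sqrt (2 * pi)" using pi_gt3 by simp
      moreover have "exp (- x\<^sup>2 / 2) \<le> 1" by simp
      ultimately have "exp (- x\<^sup>2 / 2) \<le> sqrt (2 * pi)" by linarith
      then have "exp (- x\<^sup>2 / 2) / sqrt (2 * pi) \<le> 1" by (simp add: divide_le_eq)
      then show ?thesis by (simp add: std_normal_density_def)
    qed
    then have "(std_normal_density x)\<^sup>2 \<le> std_normal_density x" for x
      by (simp add: power2_eq_square mult_left_le_one_le)
    then show "AE x in lborel. norm ((std_normal_density x)\<^sup>2) \<le> norm (std_normal_density x)"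
      by simp
  qed simp
  then show ?thesis by (simp add: L2_space_def)
qed

text \<open>A function in $L^1 \cap L^2$ whose Fourier transform has no zeros: convolution with it loses no information
  about an integrable function.\<close>

lemma fourier_std_normal_density: "fourier std_normal_density \<xi> = complex_of_real (exp (- \<xi>\<^sup>2 / 2))"
proof -
  have "char std_normal_distribution \<xi> = fourier std_normal_density \<xi>"
    unfolding char_def fourier_scaleR by (rule integral_density) auto
  then show ?thesis by (simp add: char_std_normal_distribution)
qed

text \<open>Pairings with all \<open>\<phi>\<close> determine \<open>C * \<psi>\<close>. For the Gaussian \<open>\<psi>\<close> the transform
  of \<open>C\<close> is recovered by division.\<close>

lemma covariance_function_unique:
  assumes C: "covariance_function M X C" and D: "covariance_function M X D"
  shows "AE h in lborel. C h = D h"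
proof -
  let ?g = "std_normal_density"
  have Ci: "integrable lborel C" and Di: "integrable lborel D"
    using C D by (auto simp: covariance_function_def)
  have g: "?g \<in> L2_space" by (rule std_normal_density_L2)
  have "AE x in lborel. fun_convolution C ?g x = fun_convolution D ?g x"
  proof (rule L2_AE_eqI)
    fix h assume h: "h \<in> L2_space"
    have "L2_inner h (fun_convolution C ?g) = L2_inner h (fun_convolution D ?g)"
      using C D h g unfolding covariance_function_def covariance_pairing by metis
    then show "L2_inner (fun_convolution C ?g) h = L2_inner (fun_convolution D ?g) h"
      by (simp only: L2_inner_commute[of _ h])
  qed (intro fun_convolution_L2 Ci Di g)+
  then have "fourier (fun_convolution C ?g) \<xi> = fourier (fun_convolution D ?g) \<xi>" for \<xi>
    by (intro fourier_cong_AE L2_space_borel fun_convolution_L2 Ci Di g)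
  then have "fourier C \<xi> = fourier D \<xi>" for \<xi>
    by (simp add: fourier_fun_convolution Ci Di fourier_std_normal_density)
  with Ci Di show ?thesis by (rule fourier_injective)
qed

section \<open>The solution, its spectrum and its covariance\<close>

theorem theorem3p2:
  fixes n :: nat and \<beta> \<mu> \<sigma> :: real
    and M :: "'a measure" and \<E> X :: "(real \<Rightarrow> real) \<Rightarrow> 'a \<Rightarrow> real"
    and u :: "real \<Rightarrow> real \<Rightarrow> real" and K :: "real \<Rightarrow> real"
    and N :: "'b measure" and W :: "'b \<Rightarrow> real"
  assumes "n \<ge> 1" and "\<beta> > 0" and "\<mu> > 0"
    and "white_noise M \<sigma> \<E>"
    and "fundamental_solution n u"
    and K_def: "K = (\<lambda>x. 1 / Gamma \<beta> *
          (LINT w:{0<..}|lborel. w powr (\<beta> - 1) * exp (- \<mu> * w) * u x w))"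
    and X_def: "X = kernel_process \<E> K"
    and "prob_space N"
    and "distributed N lborel W (\<lambda>w. ennreal (gamma_density (2 * \<beta>) \<mu> w))"
  shows "(AE x in lborel. set_integrable lborel {0<..}
            (\<lambda>w. w powr (\<beta> - 1) * exp (- \<mu> * w) * u x w))
       \<and> integrable lborel K
       \<and> fractional_solution M \<E> n \<mu> \<beta> X
       \<and> (\<exists>C. covariance_function M X C)
       \<and> (\<forall>C. covariance_function M X C \<longrightarrow>
            (\<forall>\<tau>. spectral_function C \<tau> =
               complex_of_real (\<sigma>\<^sup>2 / (\<mu> + \<tau> ^ (2 * n)) powr (2 * \<beta>))) \<and>
            (AE h in lborel. integrable N (\<lambda>\<omega>. u h (W \<omega>)) \<and>
               C h = \<sigma>\<^sup>2 / \<mu> powr (2 * \<beta>) *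
                 prob_space.expectation N (\<lambda>\<omega>. u h (W \<omega>))))"
proof -
  interpret heat_kernel n u by unfold_locales fact+
  note \<beta> = \<open>\<beta> > 0\<close> and \<mu> = \<open>\<mu> > 0\<close> and noise = \<open>white_noise M \<sigma> \<E>\<close>
    and W = \<open>distributed N lborel W (\<lambda>w. ennreal (gamma_density (2 * \<beta>) \<mu> w))\<close>
  have \<Gamma>: "0 < Gamma \<beta>" "0 < Gamma (2 * \<beta>)" using \<beta> by (simp_all add: Gamma_real_pos)
  have i: "integrable lborel (gamma_weight \<beta> \<mu>)" and i2: "integrable lborel (gamma_weight (2 * \<beta>) \<mu>)"
    using \<beta> \<mu> by (simp_all add: gamma_weight_integrable)
  have weight: "indicator {0<..} w *\<^sub>R (w powr (\<beta> - 1) * exp (- \<mu> * w) * u x w) =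
      Gamma \<beta> * (gamma_weight \<beta> \<mu> w * u x w)" for x w
    using \<Gamma> by (simp add: gamma_weight_def)
  have K: "K = mixture (gamma_weight \<beta> \<mu>)"
    unfolding K_def mixture_def set_lebesgue_integral_def weight using \<Gamma> by simp
  have Ki: "integrable lborel K" unfolding K using i by (rule mixture_integrable)
  have K_even: "K (- x) = K x" for x unfolding K by (rule mixture_even)

  have 1: "AE x in lborel. set_integrable lborel {0<..} (\<lambda>w. w powr (\<beta> - 1) * exp (- \<mu> * w) * u x w)"
    using mixture_AE_integrable[OF i] unfolding set_integrable_def weight by eventually_elim simp

  have "L2_adjoint (fun_convolution K) (fun_convolution K)"
    unfolding L2_adjoint_def
    using fun_convolution_L2[OF Ki] L2_inner_fun_convolution_symmetric[OF Ki K_even] by auto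
  then have 3: "fractional_solution M \<E> n \<mu> \<beta> X"
    using heat_semigroup_generated negative_fractional_power_heat_semigroup[OF \<beta> \<mu>]
    unfolding fractional_solution_def X_def kernel_process_def K by (intro exI conjI) auto

  define C\<^sub>0 where "C\<^sub>0 = (\<lambda>h. \<sigma>\<^sup>2 * fun_convolution K K h)"
  have C\<^sub>0: "covariance_function M X C\<^sub>0"
    unfolding X_def C\<^sub>0_def by (rule covariance_function_kernel_process[OF noise Ki K_even])
  have C\<^sub>0_mixture: "AE h in lborel. C\<^sub>0 h = \<sigma>\<^sup>2 * mixture (gamma_weight (2 * \<beta>) \<mu>) h"
    using gamma_mixture_convolution[OF \<beta> \<beta> \<mu>] unfolding C\<^sub>0_def K by eventually_elim simp

  have expectation: "AE h in lborel. integrable N (\<lambda>\<omega>. u h (W \<omega>)) \<and>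
      prob_space.expectation N (\<lambda>\<omega>. u h (W \<omega>)) = \<mu> powr (2 * \<beta>) * mixture (gamma_weight (2 * \<beta>) \<mu>) h"
    using mixture_AE_integrable[OF i2]
  proof eventually_elim
    case (elim h)
    have [measurable]: "(\<lambda>w. u h w) \<in> borel_measurable lborel" by measurable
    have density: "gamma_density (2 * \<beta>) \<mu> w * u h w = \<mu> powr (2 * \<beta>) * (gamma_weight (2 * \<beta>) \<mu> w * u h w)" for w
      by (simp add: gamma_density_def gamma_weight_def)
    have nonneg: "0 \<le> gamma_density (2 * \<beta>) \<mu> w" for w
      using \<Gamma> by (simp add: gamma_density_def)
    have "integrable N (\<lambda>\<omega>. u h (W \<omega>))"
      using distributed_integrable[OF W, of "\<lambda>w. u h w"] nonneg elim by (simp add: density)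
    moreover have "prob_space.expectation N (\<lambda>\<omega>. u h (W \<omega>)) = \<mu> powr (2 * \<beta>) * mixture (gamma_weight (2 * \<beta>) \<mu>) h"
      using distributed_integral[OF W, of "\<lambda>w. u h w"] nonneg by (simp add: density mixture_def)
    ultimately show ?case ..
  qed

  have 5: "(\<forall>\<tau>. spectral_function C \<tau> = complex_of_real (\<sigma>\<^sup>2 / (\<mu> + \<tau> ^ (2 * n)) powr (2 * \<beta>))) \<and>
      (AE h in lborel. integrable N (\<lambda>\<omega>. u h (W \<omega>)) \<and>
         C h = \<sigma>\<^sup>2 / \<mu> powr (2 * \<beta>) * prob_space.expectation N (\<lambda>\<omega>. u h (W \<omega>)))"
    if C: "covariance_function M X C" for C
  proof
    have C_mixture: "AE h in lborel. C h = \<sigma>\<^sup>2 * mixture (gamma_weight (2 * \<beta>) \<mu>) h"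
      using covariance_function_unique[OF C C\<^sub>0] C\<^sub>0_mixture by eventually_elim simp
    have "C \<in> borel_measurable borel" "mixture (gamma_weight (2 * \<beta>) \<mu>) \<in> borel_measurable borel"
      using C integrable_borel mixture_integrable[OF i2] by (auto simp: covariance_function_def)
    then have "fourier C \<tau> = fourier (\<lambda>h. \<sigma>\<^sup>2 * mixture (gamma_weight (2 * \<beta>) \<mu>) h) \<tau>" for \<tau>
      using C_mixture by (intro fourier_cong_AE) auto
    then show "\<forall>\<tau>. spectral_function C \<tau> = complex_of_real (\<sigma>\<^sup>2 / (\<mu> + \<tau> ^ (2 * n)) powr (2 * \<beta>))"
      using \<beta> \<mu> by (simp add: fourier_cmult fourier_gamma_mixture powr_minus_divide)
    show "AE h in lborel. integrable N (\<lambda>\<omega>. u h (W \<omega>)) \<and>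
         C h = \<sigma>\<^sup>2 / \<mu> powr (2 * \<beta>) * prob_space.expectation N (\<lambda>\<omega>. u h (W \<omega>))"
      using C_mixture expectation by eventually_elim (use \<mu> in simp)
  qed
  from 1 Ki 3 C\<^sub>0 5 show ?thesis by blast
qed

end
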